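(* Let $(X_0,X_1)$ and $(Y_0,Y_1)$ be couples of Banach lattices with the Fatou property (on $\sigma$-finite measure spaces) and let $T:(X_0,X_1)\to(Y_0,Y_1)$ be a positive operator. Assume that $T:X_0^{1-\theta_0}X_1^{\theta_0}\to Y_0^{1-\theta_0}Y_1^{\theta_0}$ is an order isomorphism for some $\theta_0\in(0,1)$. Then $T:X_0^{1-\theta_1}X_1^{\theta_1}\to Y_0^{1-\theta_1}Y_1^{\theta_1}$ is an order isomorphism for every $\theta_1\in(0,1)$.
   Context: A Banach lattice on a $\sigma$-finite measure space $(\Omega,\Sigma,\mu)$ is a Banach space $X\subset L^0(\mu)$ containing a $\mu$-a.e. strictly positive element and solid: if $f\in L^0(\mu)$, $g\in X$, $|f|\le|g|$ a.e., then $f\in X$ and $\|f\|_X\le\|g\|_X$. Fatou property: if $0\le f_n\uparrow f$ a.e. with $f_n\in X$ and $\sup_n\|f_n\|_X<\infty$, then $f\in X$ and $\|f_n\|_X\uparrow\|f\|_X$. The Calderón product $X_0^{1-\theta}X_1^\theta$ consists of $f\in L^0(\mu)$ with $|f|\le\lambda|f_0|^{1-\theta}|f_1|^\theta$ a.e. for some $\lambda>0$ and $\|f_j\|_{X_j}\le1$, normed by the infimum of such $\lambda$. An operator $T:(X_0,X_1)\to(Y_0,Y_1)$ is a linear map $X_0+X_1\to Y_0+Y_1$ bounded $X_j\to Y_j$; it is positive if $Tf\ge0$ whenever $f\ge0$. An order isomorphism between Banach lattices is a linear bijection $T$ such that $T$ and $T^{-1}$ are both positive (equivalently, a bijective lattice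 homomorphism). *)

theory Defs
  imports "HOL-Analysis.Analysis"
begin

text \<open>A Banach lattice on a measure space M is encoded by its (extended) norm functional
  N :: ('a => real) => ennreal; the lattice consists of the measurable functions f
  with N f < infinity (functions are identified when equal a.e.).  Real scalars.\<close>

definition lat_mem :: "'a measure \<Rightarrow> (('a \<Rightarrow> real) \<Rightarrow> ennreal) \<Rightarrow> ('a \<Rightarrow> real) \<Rightarrow> bool" where
  "lat_mem M N f \<longleftrightarrow> f \<in> borel_measurable M \<and> N f < \<infinity>"

definition banach_lattice :: "'a measure \<Rightarrow> (('a \<Rightarrow> real) \<Rightarrow> ennreal) \<Rightarrow> bool" where
  "banach_lattice M N \<longleftrightarrow>
     sigma_finite_measure M
   \<comment> \<open>norm axioms\<close>
   \<and> (\<forall>f c. f \<in> borel_measurable M \<longrightarrow> N (\<lambda>x. c * f x) = ennreal \<bar>c\<bar> * N f)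
   \<and> (\<forall>f g. f \<in> borel_measurable M \<longrightarrow> g \<in> borel_measurable M \<longrightarrow>
            N (\<lambda>x. f x + g x) \<le> N f + N g)
   \<and> (\<forall>f. f \<in> borel_measurable M \<longrightarrow> (N f = 0 \<longleftrightarrow> (AE x in M. f x = 0)))
   \<comment> \<open>solidity (includes ideal property and monotonicity of the norm)\<close>
   \<and> (\<forall>f g. f \<in> borel_measurable M \<longrightarrow> g \<in> borel_measurable M \<longrightarrow>
            (AE x in M. \<bar>f x\<bar> \<le> \<bar>g x\<bar>) \<longrightarrow> N f \<le> N g)
   \<comment> \<open>contains an a.e. strictly positive element\<close>
   \<and> (\<exists>w. lat_mem M N w \<and> (AE x in M. w x > 0))
   \<comment> \<open>completeness (Banach space)\<close>
   \<and> (\<forall>fs. (\<forall>n. lat_mem M N (fs n)) \<longrightarrow>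
          (\<forall>e>0. \<exists>K. \<forall>m\<ge>K. \<forall>n\<ge>K. N (\<lambda>x. fs m x - fs n x) < e) \<longrightarrow>
          (\<exists>f. lat_mem M N f \<and> ((\<lambda>n. N (\<lambda>x. fs n x - f x)) \<longlongrightarrow> 0) sequentially))"

definition fatou_property :: "'a measure \<Rightarrow> (('a \<Rightarrow> real) \<Rightarrow> ennreal) \<Rightarrow> bool" where
  "fatou_property M N \<longleftrightarrow>
     (\<forall>fs f. (\<forall>n. lat_mem M N (fs n)) \<longrightarrow> f \<in> borel_measurable M \<longrightarrow>
        (AE x in M. (\<forall>n. 0 \<le> fs n x \<and> fs n x \<le> fs (Suc n) x) \<and> (\<lambda>n. fs n x) \<longlonglongrightarrow> f x) \<longrightarrow>
        (SUP n. N (fs n)) < \<infinity> \<longrightarrow>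
        lat_mem M N f \<and> N f = (SUP n. N (fs n)))"

definition sum_mem :: "'a measure \<Rightarrow> (('a \<Rightarrow> real) \<Rightarrow> ennreal) \<Rightarrow> (('a \<Rightarrow> real) \<Rightarrow> ennreal)
    \<Rightarrow> ('a \<Rightarrow> real) \<Rightarrow> bool" where
  "sum_mem M N0 N1 f \<longleftrightarrow> f \<in> borel_measurable M \<and>
     (\<exists>f0 f1. lat_mem M N0 f0 \<and> lat_mem M N1 f1 \<and> (AE x in M. f x = f0 x + f1 x))"

definition calderon :: "'a measure \<Rightarrow> (('a \<Rightarrow> real) \<Rightarrow> ennreal) \<Rightarrow> (('a \<Rightarrow> real) \<Rightarrow> ennreal)
    \<Rightarrow> real \<Rightarrow> ('a \<Rightarrow> real) \<Rightarrow> ennreal" where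
  "calderon M N0 N1 \<theta> f =
     (if f \<in> borel_measurable M then
        Inf {ennreal c | c. c > 0 \<and> (\<exists>f0 f1. f0 \<in> borel_measurable M \<and> f1 \<in> borel_measurable M \<and>
              N0 f0 \<le> 1 \<and> N1 f1 \<le> 1 \<and>
              (AE x in M. \<bar>f x\<bar> \<le> c * \<bar>f0 x\<bar> powr (1 - \<theta>) * \<bar>f1 x\<bar> powr \<theta>))}
      else \<infinity>)"

definition positive_operator ::
  "'a measure \<Rightarrow> (('a \<Rightarrow> real) \<Rightarrow> ennreal) \<Rightarrow> (('a \<Rightarrow> real) \<Rightarrow> ennreal) \<Rightarrow>
   'b measure \<Rightarrow> (('b \<Rightarrow> real) \<Rightarrow> ennreal) \<Rightarrow> (('b \<Rightarrow> real) \<Rightarrow> ennreal) \<Rightarrow>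
   (('a \<Rightarrow> real) \<Rightarrow> ('b \<Rightarrow> real)) \<Rightarrow> bool" where
  "positive_operator M NX0 NX1 M' NY0 NY1 T \<longleftrightarrow>
     (\<forall>f. sum_mem M NX0 NX1 f \<longrightarrow> T f \<in> borel_measurable M')
   \<and> (\<forall>f g. sum_mem M NX0 NX1 f \<longrightarrow> sum_mem M NX0 NX1 g \<longrightarrow> (AE x in M. f x = g x) \<longrightarrow>
          (AE y in M'. T f y = T g y))
   \<and> (\<forall>f g a b. sum_mem M NX0 NX1 f \<longrightarrow> sum_mem M NX0 NX1 g \<longrightarrow>
          (AE y in M'. T (\<lambda>x. a * f x + b * g x) y = a * T f y + b * T g y))
   \<and> (\<exists>C\<ge>0. \<forall>f. lat_mem M NX0 f \<longrightarrow> NY0 (T f) \<le> ennreal C * NX0 f)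
   \<and> (\<exists>C\<ge>0. \<forall>f. lat_mem M NX1 f \<longrightarrow> NY1 (T f) \<le> ennreal C * NX1 f)
   \<and> (\<forall>f. sum_mem M NX0 NX1 f \<longrightarrow> (AE x in M. f x \<ge> 0) \<longrightarrow> (AE y in M'. T f y \<ge> 0))"

definition order_isomorphism ::
  "'a measure \<Rightarrow> (('a \<Rightarrow> real) \<Rightarrow> ennreal) \<Rightarrow> 'b measure \<Rightarrow> (('b \<Rightarrow> real) \<Rightarrow> ennreal) \<Rightarrow>
   (('a \<Rightarrow> real) \<Rightarrow> ('b \<Rightarrow> real)) \<Rightarrow> bool" where
  "order_isomorphism M NX M' NY T \<longleftrightarrow>
     (\<forall>f. lat_mem M NX f \<longrightarrow> lat_mem M' NY (T f))
   \<and> (\<forall>f g. lat_mem M NX f \<longrightarrow> lat_mem M NX g \<longrightarrow> (AE y in M'. T f y = T g y) \<longrightarrow>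
          (AE x in M. f x = g x))
   \<and> (\<forall>g. lat_mem M' NY g \<longrightarrow> (\<exists>f. lat_mem M NX f \<and> (AE y in M'. T f y = g y)))
   \<and> (\<forall>f. lat_mem M NX f \<longrightarrow> (AE x in M. f x \<ge> 0) \<longrightarrow> (AE y in M'. T f y \<ge> 0))
   \<and> (\<forall>f. lat_mem M NX f \<longrightarrow> (AE y in M'. T f y \<ge> 0) \<longrightarrow> (AE x in M. f x \<ge> 0))"

end

theory Submission
  imports Defs
begin

text \<open>
  Up to constants, \<open>a\<^sup>1\<^sup>-\<^sup>t b\<^sup>t\<close> is the infimum of \<open>s\<^sup>t a + s\<^sup>t\<^sup>-\<^sup>1 b\<close> over rational \<open>s > 0\<close>. Hence every
  positive operator satisfies \<open>T (a\<^sup>1\<^sup>-\<^sup>t b\<^sup>t) \<le> 3 (T a)\<^sup>1\<^sup>-\<^sup>t (T b)\<^sup>t\<close>, and so does the inverse \<open>S\<close> of \<open>T\<close> on the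
  Calderon products with parameter \<open>\<theta>\<close>. The key point is that \<open>S\<close> is bounded from \<open>Y\<^sub>j\<close> to \<open>X\<^sub>j\<close> wherever it is
  defined. If \<open>p = S g\<close> with \<open>g\<close> in the unit ball of \<open>Y\<^sub>0\<close>, then for \<open>v\<close> in the unit ball of \<open>X\<^sub>1\<close> the
  product \<open>p\<^sup>1\<^sup>-\<^sup>\<theta> v\<^sup>\<theta>\<close> is dominated by \<open>3 S (g\<^sup>1\<^sup>-\<^sup>\<theta> (T v)\<^sup>\<theta>)\<close>, hence by \<open>C u\<^sup>1\<^sup>-\<^sup>\<theta> w\<^sup>\<theta>\<close> with \<open>u\<close>, \<open>w\<close> in the
  unit balls of \<open>X\<^sub>0\<close>, \<open>X\<^sub>1\<close>. Replacing \<open>v\<close> by \<open>w\<close> and repeating this \<open>n\<close> times, the intermediate factors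
  cancel in the product of the \<open>n\<close> inequalities; taking \<open>n\<close>-th roots, \<open>p\<close> is bounded by a constant times
  the lower limit of geometric, hence of arithmetic, means of elements of the unit ball of \<open>X\<^sub>0\<close>, and the
  Fatou property bounds the norm of \<open>p\<close>. So the interval below a Calderon product of \<open>Y\<^sub>0\<close> and \<open>Y\<^sub>1\<close> with
  any parameter is covered by the image of one of \<open>X\<^sub>0\<close> and \<open>X\<^sub>1\<close>.
\<close>

section \<open>Scalar inequalities\<close>

text \<open>Compare \<open>b\<close> with \<open>s * a\<close> and replace the smaller of the two by
  the larger: one of the two terms on the right then dominates the product by itself.\<close>

lemma powr_product_le_sum:
  fixes a b s t :: real
  assumes "0 \<le> a" "0 \<le> b" "0 < s" "0 < t" "t < 1"
  shows "a powr (1 - t) * b powr t \<le> s powr t * a + s powr (t - 1) * b"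
proof (cases "b \<le> s * a")
  case True
  have "a powr (1 - t) * b powr t \<le> a powr (1 - t) * (s * a) powr t"
    using assms True by (intro mult_left_mono powr_mono2) auto
  also have "\<dots> = s powr t * (a powr (1 - t) * a powr t)"
    using assms by (simp add: powr_mult)
  also have "\<dots> = s powr t * a"
    using assms by (simp flip: powr_add)
  finally show ?thesis using assms by (simp add: add_increasing2)
next
  case False
  then have "a \<le> b / s" using assms by (simp add: field_simps)
  then have "a powr (1 - t) * b powr t \<le> (b / s) powr (1 - t) * b powr t"
    using assms by (intro mult_right_mono powr_mono2) auto
  also have "\<dots> = s powr (t - 1) * (b powr (1 - t) * b powr t)"
    using assms by (simp add: powr_divide powr_diff)
  also have "\<dots> = s powr (t - 1) * b"
    using assms by (simp flip: powr_add)
  finally show ?thesis using assms by (simp add: add_increasing)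
qed

text \<open>At \<open>s = b / a\<close> both terms equal the product. A rational \<open>s\<close>
  between \<open>b / a\<close> and \<open>2 * (b / a)\<close> at most doubles the first term and
  does not increase the second, whence 3 = 2 + 1. Only rational \<open>s\<close> are tested, so that
  a.e. inequalities for the single \<open>s\<close> can be combined off one null set.\<close>

lemma le_powr_product_of_le_sums:
  fixes a b k t :: real
  assumes "0 \<le> a" "0 \<le> b" "0 < t" "t < 1"
    and le: "\<And>s. s \<in> \<rat> \<Longrightarrow> 0 < s \<Longrightarrow> k \<le> s powr t * a + s powr (t - 1) * b"
  shows "k \<le> 3 * (a powr (1 - t) * b powr t)"
proof -
  consider "a = 0" | "b = 0" | "0 < a" "0 < b" using assms by fastforce
  then show ?thesis
  proof cases
    case 1
    \<comment> \<open>Only the term with \<open>b\<close> is left, and it vanishes as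
      \<open>s\<close> tends to infinity.\<close>
    have "(\<lambda>n. real (Suc n) powr (t - 1) * b) \<longlonglongrightarrow> 0 * b"
      using assms
      by (intro tendsto_mult_right tendsto_neg_powr filterlim_compose[OF filterlim_real_sequentially filterlim_Suc]) auto
    moreover have "k \<le> real (Suc n) powr (t - 1) * b" for n
      using le[of "real (Suc n)"] 1 by simp
    ultimately have "k \<le> 0" by (auto intro: LIMSEQ_le_const)
    then show ?thesis using 1 by simp
  next
    case 2
    \<comment> \<open>Here \<open>s = 1 / (n + 1)\<close> tends to 0, which removes the term with
      \<open>a\<close>.\<close>
    have "(\<lambda>n. real (Suc n) powr (- t) * a) \<longlonglongrightarrow> 0 * a"
      using assms
      by (intro tendsto_mult_right tendsto_neg_powr filterlim_compose[OF filterlim_real_sequentially filterlim_Suc]) auto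
    moreover have "k \<le> real (Suc n) powr (- t) * a" for n
      using le[of "1 / real (Suc n)"] 2 by (simp add: powr_divide powr_minus_divide)
    ultimately have "k \<le> 0" by (auto intro: LIMSEQ_le_const)
    then show ?thesis using 2 by simp
  next
    case 3
    obtain s where s: "s \<in> \<rat>" "b / a < s" "s < 2 * (b / a)"
      using Rats_dense_in_real[of "b / a" "2 * (b / a)"] 3 by (auto simp: field_simps)
    have "0 < b / a" using 3 by simp
    with s have "0 < s" by linarith
    have P: "(b / a) powr t * a = a powr (1 - t) * b powr t"
      using 3 by (simp add: powr_divide powr_diff)
    have Q: "(b / a) powr (t - 1) * b = a powr (1 - t) * b powr t"
      using 3 by (simp add: powr_divide powr_diff)
    have "s powr t * a \<le> (2 * (b / a)) powr t * a"
      using s 3 assms \<open>0 < s\<close> by (intro mult_right_mono powr_mono2) auto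
    also have "\<dots> = 2 powr t * ((b / a) powr t * a)"
      using 3 by (simp only: powr_mult mult.assoc)
    also have "\<dots> \<le> 2 * ((b / a) powr t * a)"
      using 3 assms powr_mono[of t 1 "2::real"] by (intro mult_right_mono) auto
    finally have "s powr t * a \<le> 2 * (a powr (1 - t) * b powr t)" unfolding P .
    moreover have "s powr (t - 1) * b \<le> a powr (1 - t) * b powr t"
      unfolding Q[symmetric] using s 3 assms \<open>0 < s\<close> \<open>0 < b / a\<close>
      by (intro mult_right_mono powr_mono2') auto
    ultimately show ?thesis using le[OF s(1) \<open>0 < s\<close>] by linarith
  qed
qed

text \<open>This replaces taking \<open>n\<close>-th roots: if \<open>P > 2 * D * G n\<close>, the
  hypothesis yields \<open>a \<le> (1/2) ^ n * b\<close>, which fails for large \<open>n\<close>.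
  The factor 2 thus absorbs the fixed quantities \<open>a\<close> and \<open>b\<close>.\<close>

lemma eventually_le_of_power_le:
  fixes P D a b :: real and G :: "nat \<Rightarrow> real"
  assumes "0 \<le> P" "0 < a" "0 < D" "\<And>n. 0 \<le> G n"
    and le: "\<And>n. P ^ n * a \<le> D ^ n * G n ^ n * b"
  shows "\<forall>\<^sub>F n in sequentially. P \<le> 2 * D * G n"
proof -
  have "(\<lambda>n. (1/2::real) ^ n * b) \<longlonglongrightarrow> 0 * b"
    by (intro tendsto_mult_right LIMSEQ_realpow_zero) auto
  then have "\<forall>\<^sub>F n in sequentially. (1/2) ^ n * b < a"
    using \<open>0 < a\<close> by (intro order_tendstoD(2)) auto
  moreover have "P \<le> 2 * D * G n" if n: "(1/2) ^ n * b < a" for n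
  proof (rule ccontr)
    assume "\<not> ?thesis"
    then have lt: "D * G n \<le> P / 2" and "0 < P" using assms by (auto simp: not_le intro: le_less_trans[of 0 "2 * D * G n"])
    have "0 \<le> b"
    proof (rule ccontr)
      assume "\<not> 0 \<le> b"
      then have "D ^ n * G n ^ n * b \<le> 0" using assms by (intro mult_nonneg_nonpos) auto
      moreover have "0 < P ^ n * a" using \<open>0 < P\<close> \<open>0 < a\<close> by simp
      ultimately show False using le[of n] by linarith
    qed
    have "P ^ n * a \<le> (D * G n) ^ n * b" using le[of n] by (simp add: power_mult_distrib)
    also have "\<dots> \<le> (P / 2) ^ n * b"
      using lt assms \<open>0 \<le> b\<close> by (intro mult_right_mono power_mono) auto
    also have "\<dots> = P ^ n * ((1/2) ^ n * b)" by (simp add: power_divide)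
    also have "\<dots> < P ^ n * a" using n \<open>0 < P\<close> by simp
    finally show False by simp
  qed
  ultimately show ?thesis by (auto elim: eventually_mono)
qed

text \<open>The arithmetic-geometric mean inequality, raised to the \<open>n\<close>-th power; for
  \<open>n = 0\<close> both sides are 1.\<close>

lemma prod_le_mean_power:
  fixes u :: "nat \<Rightarrow> real"
  assumes "\<And>i. 0 \<le> u i"
  shows "(\<Prod>i<n. u i) \<le> ((\<Sum>i<n. u i) / real n) ^ n"
proof (cases "n = 0")
  case False
  have "root n (\<Prod>i<n. u i) \<le> (\<Sum>i<n. u i) / real n"
    using arith_geom_mean[of "{..<n}" u] assms False
    by (simp add: root_powr_inverse prod_nonneg lessThan_empty_iff sum_divide_distrib field_simps)
  then have "root n (\<Prod>i<n. u i) ^ n \<le> ((\<Sum>i<n. u i) / real n) ^ n"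
    using assms False by (intro power_mono) (auto simp: prod_nonneg)
  then show ?thesis using False assms by (simp add: prod_nonneg)
qed simp

section \<open>Lattices with the Fatou property\<close>

locale fatou_lattice =
  fixes M :: "'a measure" and N :: "('a \<Rightarrow> real) \<Rightarrow> ennreal"
  assumes lattice: "banach_lattice M N" and fatou: "fatou_property M N"
begin

section \<open>Norm rules and weak units\<close>

lemma norm_scale: "f \<in> borel_measurable M \<Longrightarrow> N (\<lambda>x. c * f x) = ennreal \<bar>c\<bar> * N f"
  using lattice unfolding banach_lattice_def by blast

lemma norm_triangle:
  "f \<in> borel_measurable M \<Longrightarrow> g \<in> borel_measurable M \<Longrightarrow> N (\<lambda>x. f x + g x) \<le> N f + N g"
  using lattice unfolding banach_lattice_def by blast

lemma norm_eq_0_iff: "f \<in> borel_measurable M \<Longrightarrow> N f = 0 \<longleftrightarrow> (AE x in M. f x = 0)"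
  using lattice unfolding banach_lattice_def by blast

lemma norm_mono:
  "f \<in> borel_measurable M \<Longrightarrow> g \<in> borel_measurable M \<Longrightarrow> AE x in M. \<bar>f x\<bar> \<le> \<bar>g x\<bar> \<Longrightarrow> N f \<le> N g"
  using lattice unfolding banach_lattice_def by blast

lemma norm_complete:
  assumes "\<And>n. lat_mem M N (fs n)"
    and "\<And>e. e > 0 \<Longrightarrow> \<exists>K. \<forall>m\<ge>K. \<forall>n\<ge>K. N (\<lambda>x. fs m x - fs n x) < e"
  obtains f where "lat_mem M N f" "(\<lambda>n. N (\<lambda>x. fs n x - f x)) \<longlonglongrightarrow> 0"
proof -
  have "\<exists>f. lat_mem M N f \<and> (\<lambda>n. N (\<lambda>x. fs n x - f x)) \<longlonglongrightarrow> 0"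
    using lattice assms unfolding banach_lattice_def by blast
  then show ?thesis using that by blast
qed

lemma norm_abs: "f \<in> borel_measurable M \<Longrightarrow> N (\<lambda>x. \<bar>f x\<bar>) = N f"
  by (intro antisym norm_mono) auto

lemma norm_scale_le:
  assumes "f \<in> borel_measurable M" "N f \<le> ennreal K" "0 \<le> c" "0 \<le> K"
  shows "N (\<lambda>x. c * f x) \<le> ennreal (c * K)"
  using assms by (simp add: norm_scale ennreal_mult mult_left_mono)

lemma norm_sum:
  assumes "\<And>i. i \<in> I \<Longrightarrow> f i \<in> borel_measurable M"
  shows "N (\<lambda>x. \<Sum>i\<in>I. f i x) \<le> (\<Sum>i\<in>I. N (f i))"
  using assms
proof (induction I rule: infinite_finite_induct)
  case (insert i I)
  have "N (\<lambda>x. f i x + (\<Sum>i\<in>I. f i x)) \<le> N (f i) + N (\<lambda>x. \<Sum>i\<in>I. f i x)"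
    using insert by (intro norm_triangle) auto
  also have "\<dots> \<le> N (f i) + (\<Sum>i\<in>I. N (f i))" using insert by (intro add_left_mono) auto
  finally show ?case using insert by simp
qed (simp_all add: norm_eq_0_iff)

lemma norm_bounded_obtain:
  assumes "lat_mem M N f"
  obtains K where "0 < K" "N f \<le> ennreal K"
proof -
  obtain r where "N f = ennreal r" "0 \<le> r"
    using assms unfolding lat_mem_def by (cases "N f") auto
  then have "N f \<le> ennreal (r + 1)" by (simp add: ennreal_leI)
  then show ?thesis using that[of "r + 1"] \<open>0 \<le> r\<close> by auto
qed

lemma weak_unit_obtain:
  obtains w where "w \<in> borel_measurable M" "N w \<le> 1" "\<And>x. 0 \<le> w x" "AE x in M. 0 < w x"
proof -
  obtain w where w: "lat_mem M N w" "AE x in M. w x > 0"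
    using lattice unfolding banach_lattice_def by blast
  obtain K where K: "0 < K" "N w \<le> ennreal K" using norm_bounded_obtain[OF w(1)] .
  have [measurable]: "w \<in> borel_measurable M" using w(1) by (simp add: lat_mem_def)
  have "N (\<lambda>x. 1 / K * \<bar>w x\<bar>) \<le> ennreal (1 / K * K)"
    using K by (intro norm_scale_le) (auto simp: norm_abs)
  then show ?thesis using K w(2)
    by (intro that[of "\<lambda>x. 1 / K * \<bar>w x\<bar>"]) (auto elim!: eventually_mono)
qed

text \<open>Completeness sums the series with terms \<open>(1/2) ^ n * a n\<close>, and each term
  lies below the sum. A whole sequence in the unit ball is thus put under one element at the price
  of \<open>2 ^ n\<close>, a growth that costs only a constant after \<open>n\<close>-th
  roots.\<close>

lemma geometric_majorant:
  assumes meas[measurable]: "\<And>n. a n \<in> borel_measurable M"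
    and bd: "\<And>n. N (a n) \<le> 1" and nn: "\<And>n x. 0 \<le> a n x"
  obtains A where "A \<in> borel_measurable M" "\<And>x. 0 \<le> A x" "N A < \<infinity>"
    "AE x in M. \<forall>n. a n x \<le> 2 ^ n * A x"
proof -
  define s where "s n x = (\<Sum>i<n. (1/2) ^ i * a i x)" for n x
  have s_meas[measurable]: "s n \<in> borel_measurable M" for n unfolding s_def by measurable
  have s_diff: "N (\<lambda>x. s m x - s n x) \<le> ennreal (2 * (1/2) ^ n)" if "n \<le> m" for m n
  proof -
    have "s m x - s n x = (\<Sum>i\<in>{n..<m}. (1/2) ^ i * a i x)" for x
      unfolding s_def using sum_diff_nat_ivl[of 0 n m "\<lambda>i. (1/2) ^ i * a i x"] that
      by (simp add: lessThan_atLeast0)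
    then have "N (\<lambda>x. s m x - s n x) \<le> (\<Sum>i\<in>{n..<m}. N (\<lambda>x. (1/2) ^ i * a i x))"
      by (simp add: norm_sum)
    also have "\<dots> \<le> (\<Sum>i\<in>{n..<m}. ennreal ((1/2) ^ i))"
      using norm_scale_le[of "a i" 1 "(1/2)^i" for i] bd by (intro sum_mono) simp
    also have "\<dots> = ennreal (\<Sum>i\<in>{n..<m}. (1/2) ^ i)" by (simp add: sum_ennreal)
    also have "(\<Sum>i\<in>{n..<m}. (1/2) ^ i) \<le> 2 * (1/2::real) ^ n"
      using that
    proof (induction rule: inc_induct)
      case (step k) then show ?case by (simp add: sum.atLeast_Suc_lessThan)
    qed simp
    finally show ?thesis by (simp add: ennreal_leI)
  qed
  have N_swap: "N (\<lambda>x. f x - g x) = N (\<lambda>x. g x - f x)"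
    if "f \<in> borel_measurable M" "g \<in> borel_measurable M" for f g
    using that by (intro antisym norm_mono) auto
  have fin: "lat_mem M N (s n)" for n
    using s_diff[of 0 n] unfolding lat_mem_def by (auto simp: s_def[of 0] intro: le_less_trans)
  have lim0: "(\<lambda>n. ennreal (2 * (1/2) ^ n)) \<longlonglongrightarrow> 0"
  proof -
    have "(\<lambda>n. 2 * (1/2::real) ^ n) \<longlonglongrightarrow> 2 * 0" by (intro tendsto_intros) auto
    then show ?thesis using tendsto_ennrealI by fastforce
  qed
  obtain f where f: "lat_mem M N f" "(\<lambda>n. N (\<lambda>x. s n x - f x)) \<longlonglongrightarrow> 0"
  proof (rule norm_complete[OF fin])
    fix e :: ennreal assume "e > 0"
    then have "\<forall>\<^sub>F n in sequentially. ennreal (2 * (1/2) ^ n) < e"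
      using lim0 by (intro order_tendstoD(2)) auto
    then obtain K where K: "\<And>n. n \<ge> K \<Longrightarrow> ennreal (2 * (1/2) ^ n) < e"
      by (auto simp: eventually_sequentially)
    have "N (\<lambda>x. s m x - s n x) < e" if "m \<ge> K" "n \<ge> K" for m n
    proof (cases "n \<le> m")
      case True then show ?thesis using s_diff[OF True] K[OF that(2)] by simp
    next
      case False then show ?thesis using s_diff[of m n] K[OF that(1)] N_swap[of "s m" "s n"] by simp
    qed
    then show "\<exists>K. \<forall>m\<ge>K. \<forall>n\<ge>K. N (\<lambda>x. s m x - s n x) < e" by blast
  qed
  have [measurable]: "f \<in> borel_measurable M" using f(1) by (simp add: lat_mem_def)
  have s_mono: "s n x \<le> s m x" if "n \<le> m" for n m x
    unfolding s_def using that nn by (intro sum_mono2) auto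
  \<comment> \<open>The limit is known in norm only. For fixed \<open>n\<close>, the positive part
    of \<open>s n - f\<close> is dominated by \<open>s m - f\<close> in absolute value for every
    \<open>m \<ge> n\<close>, so its norm is 0.\<close>
  have "AE x in M. s n x \<le> f x" for n
  proof -
    have "N (\<lambda>x. max 0 (s n x - f x)) \<le> N (\<lambda>x. s m x - f x)" if "m \<ge> n" for m
      using s_mono[OF that]
      by (intro norm_mono AE_I2) (auto simp: max_def abs_if intro: order_trans, smt (verit))
    then have "N (\<lambda>x. max 0 (s n x - f x)) \<le> 0"
      using LIMSEQ_le_const[OF f(2), of "N (\<lambda>x. max 0 (s n x - f x))"] by blast
    then have "AE x in M. max 0 (s n x - f x) = 0" by (simp add: norm_eq_0_iff)
    then show ?thesis by eventually_elim (auto simp: max_def split: if_splits)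
  qed
  then have "AE x in M. \<forall>n. s n x \<le> f x" by (simp add: AE_all_countable)
  then have "AE x in M. \<forall>n. a n x \<le> 2 ^ n * \<bar>f x\<bar>"
  proof eventually_elim
    case (elim x)
    show ?case
    proof
      fix n
      have "(1/2) ^ n * a n x \<le> s (Suc n) x"
        unfolding s_def using nn by (simp add: sum_nonneg)
      also have "\<dots> \<le> \<bar>f x\<bar>" using elim by (meson abs_ge_self order_trans)
      finally show "a n x \<le> 2 ^ n * \<bar>f x\<bar>" by (simp add: field_simps)
    qed
  qed
  then show ?thesis using f(1)
    by (intro that[of "\<lambda>x. \<bar>f x\<bar>"]) (auto simp: norm_abs lat_mem_def)
qed

lemma norm_le_of_increasing:
  assumes meas[measurable]: "\<And>n. s n \<in> borel_measurable M" "f \<in> borel_measurable M"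
    and bd: "\<And>n. N (s n) \<le> ennreal K"
    and inc: "AE x in M. (\<forall>n. 0 \<le> s n x \<and> s n x \<le> s (Suc n) x) \<and> (\<lambda>n. s n x) \<longlonglongrightarrow> f x"
  shows "N f \<le> ennreal K"
proof -
  have le: "(SUP n. N (s n)) \<le> ennreal K" using bd by (auto intro: SUP_least)
  have "lat_mem M N (s n)" for n using bd[of n] by (auto simp: lat_mem_def intro: le_less_trans)
  moreover have "(SUP n. N (s n)) < \<infinity>" using le by (auto intro: le_less_trans)
  ultimately have "N f = (SUP n. N (s n))"
    using fatou inc meas(2) unfolding fatou_property_def by blast
  then show ?thesis using le by simp
qed

text \<open>The Fatou property speaks of a real-valued limit, so the point is that a norm-bounded
  increasing sequence is bounded a.e. Where it is not, every multiple of a weak unit is eventually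
  below it, which forces the weak unit to have norm 0 there.\<close>

lemma increasing_majorant:
  assumes meas[measurable]: "\<And>n. s n \<in> borel_measurable M"
    and bd: "\<And>n. N (s n) \<le> ennreal K" "0 \<le> K"
    and inc: "AE x in M. \<forall>n. 0 \<le> s n x \<and> s n x \<le> s (Suc n) x"
  obtains a where "a \<in> borel_measurable M" "\<And>x. 0 \<le> a x" "N a \<le> ennreal K"
    "AE x in M. \<forall>n. s n x \<le> a x"
proof -
  obtain w where w[measurable]: "w \<in> borel_measurable M" and wN: "N w \<le> 1" and w0: "\<And>x. 0 \<le> w x"
    and wpos: "AE x in M. 0 < w x" using weak_unit_obtain by blast
  \<comment> \<open>The weak unit restricted to the set of divergence; since \<open>w > 0\<close>
    a.e., this set is null as soon as \<open>N w' = 0\<close>.\<close>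
  define w' where "w' x = (if \<forall>k::nat. \<exists>n. real k < s n x then w x else 0)" for x
  have w'_meas[measurable]: "w' \<in> borel_measurable M" unfolding w'_def by measurable
  have w'0: "0 \<le> w' x" for x using w0 by (simp add: w'_def)
  have "ennreal (real k) * N w' \<le> ennreal K" for k
  proof -
    have "N (\<lambda>x. real k * w' x) \<le> ennreal K"
    \<comment> \<open>Cutting off at \<open>k * w'\<close> makes the sequence converge: it is
      eventually equal to \<open>k * w'\<close> where \<open>s\<close> is unbounded, and both are 0
      elsewhere.\<close>
    proof (rule norm_le_of_increasing[where s = "\<lambda>n x. min (s n x) (real k * w' x)"])
      show "N (\<lambda>x. min (s n x) (real k * w' x)) \<le> ennreal K" for n
        using inc w'0
        by (intro order_trans[OF norm_mono bd(1)[of n]]) (auto elim!: eventually_mono simp: min_def)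
      show "AE x in M. (\<forall>n. 0 \<le> min (s n x) (real k * w' x) \<and>
          min (s n x) (real k * w' x) \<le> min (s (Suc n) x) (real k * w' x)) \<and>
          (\<lambda>n. min (s n x) (real k * w' x)) \<longlonglongrightarrow> real k * w' x"
        using inc
      proof eventually_elim
        case (elim x)
        have mono: "s n x \<le> s m x" if "n \<le> m" for n m
          using lift_Suc_mono_le[of "\<lambda>n. s n x" n m] elim that by blast
        have "\<forall>\<^sub>F n in sequentially. min (s n x) (real k * w' x) = real k * w' x"
        proof (cases "\<forall>j::nat. \<exists>n. real j < s n x")
          case True
          obtain j :: nat where "real k * w' x \<le> real j" using real_arch_simple by blast
          moreover obtain n where "real j < s n x" using True by blast
          ultimately have "real k * w' x \<le> s m x" if "m \<ge> n" for m
            using mono[OF that] by linarith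
          then show ?thesis by (auto simp: eventually_sequentially intro!: exI[of _ n] min_absorb2)
        next
          case False then show ?thesis using elim by (auto simp: w'_def)
        qed
        then have "(\<lambda>n. min (s n x) (real k * w' x)) \<longlonglongrightarrow> real k * w' x" by (rule tendsto_eventually)
        then show ?case using elim w'0 by (auto simp: min_def intro: order_trans)
      qed
    qed auto
    then show ?thesis by (simp add: norm_scale)
  qed
  note kN = this
  have "N w' = 0"
  proof (rule ccontr)
    assume "N w' \<noteq> 0"
    have "N w' \<le> 1" using w0 by (intro order_trans[OF norm_mono wN]) (auto simp: w'_def)
    then obtain r where r: "N w' = ennreal r" "0 \<le> r" by (cases "N w'") (auto simp: top_unique)
    then have "0 < r" using \<open>N w' \<noteq> 0\<close> by (cases "r = 0") auto
    obtain k :: nat where "K < real k * r" using \<open>0 < r\<close> ex_less_of_nat_mult by blast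
    moreover have "real k * r \<le> K" using kN[of k] r bd(2) by (simp flip: ennreal_mult)
    ultimately show False by simp
  qed
  then have "AE x in M. w' x = 0" by (simp add: norm_eq_0_iff)
  then have conv: "AE x in M. (\<lambda>n. s n x) \<longlonglongrightarrow> lim (\<lambda>n. s n x) \<and> (\<forall>n. s n x \<le> lim (\<lambda>n. s n x))"
    using wpos inc
  proof eventually_elim
    case (elim x)
    then obtain k :: nat where k: "\<And>n. s n x \<le> real k" by (auto simp: w'_def not_less split: if_splits)
    have "incseq (\<lambda>n. s n x)" using elim by (auto simp: incseq_SucI)
    then obtain L where "(\<lambda>n. s n x) \<longlonglongrightarrow> L" "\<forall>n. s n x \<le> L"
      using incseq_convergent[of "\<lambda>n. s n x" "real k"] k by blast
    then show ?case by (simp add: limI)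
  qed
  have lim_meas: "(\<lambda>x. lim (\<lambda>n. s n x)) \<in> borel_measurable M" by measurable
  have "N (\<lambda>x. lim (\<lambda>n. s n x)) \<le> ennreal K"
    using conv inc by (intro norm_le_of_increasing[where s = s, OF meas lim_meas bd(1)]) auto
  moreover have "AE x in M. \<forall>n. s n x \<le> \<bar>lim (\<lambda>n. s n x)\<bar>"
    using conv by eventually_elim (meson abs_ge_self order_trans)
  ultimately show ?thesis using lim_meas
    by (intro that[of "\<lambda>x. \<bar>lim (\<lambda>n. s n x)\<bar>"]) (simp_all add: norm_abs)
qed

end

section \<open>Calderon products\<close>

text \<open>A bound for the Calderon norm with a witness in place of the infimum. The constant sits
  in the norms of the factors instead of in front of the product; \<open>powr_product_scale\<close>
  moves it between the two places. Factors are nonnegative everywhere, so no absolute values are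
  carried along.\<close>

definition calderon_le :: "'a measure \<Rightarrow> (('a \<Rightarrow> real) \<Rightarrow> ennreal) \<Rightarrow> (('a \<Rightarrow> real) \<Rightarrow> ennreal)
    \<Rightarrow> real \<Rightarrow> real \<Rightarrow> ('a \<Rightarrow> real) \<Rightarrow> bool" where
  "calderon_le M N0 N1 t K f \<longleftrightarrow> f \<in> borel_measurable M \<and>
     (\<exists>a b. a \<in> borel_measurable M \<and> b \<in> borel_measurable M \<and> (\<forall>x. 0 \<le> a x) \<and> (\<forall>x. 0 \<le> b x) \<and>
        N0 a \<le> ennreal K \<and> N1 b \<le> ennreal K \<and>
        (AE x in M. \<bar>f x\<bar> \<le> a x powr (1 - t) * b x powr t))"

lemma calderon_leI:
  assumes "f \<in> borel_measurable M" "a \<in> borel_measurable M" "b \<in> borel_measurable M"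
    and "\<And>x. 0 \<le> a x" "\<And>x. 0 \<le> b x" "N0 a \<le> ennreal K" "N1 b \<le> ennreal K"
    and "AE x in M. \<bar>f x\<bar> \<le> a x powr (1 - t) * b x powr t"
  shows "calderon_le M N0 N1 t K f"
  using assms unfolding calderon_le_def by blast

text \<open>This symmetry lets statements about the second end point be read off from those about
  the first.\<close>

lemma calderon_swap: "calderon M N1 N0 (1 - t) = calderon M N0 N1 t"
proof -
  have "(\<exists>f0 f1. f0 \<in> borel_measurable M \<and> f1 \<in> borel_measurable M \<and> N1 f0 \<le> 1 \<and> N0 f1 \<le> 1 \<and>
      (AE x in M. \<bar>f x\<bar> \<le> c * \<bar>f0 x\<bar> powr (1 - (1 - t)) * \<bar>f1 x\<bar> powr (1 - t))) \<longleftrightarrow>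
    (\<exists>f0 f1. f0 \<in> borel_measurable M \<and> f1 \<in> borel_measurable M \<and> N0 f0 \<le> 1 \<and> N1 f1 \<le> 1 \<and>
      (AE x in M. \<bar>f x\<bar> \<le> c * \<bar>f0 x\<bar> powr (1 - t) * \<bar>f1 x\<bar> powr t))" for f c
    by (simp add: mult_ac) blast
  then show ?thesis unfolding calderon_def by (intro ext) simp
qed

lemma powr_product_scale:
  fixes a b c t :: real
  assumes "0 < c" "0 \<le> a" "0 \<le> b"
  shows "(c * a) powr (1 - t) * (c * b) powr t = c * (a powr (1 - t) * b powr t)"
proof -
  have "(c * a) powr (1 - t) * (c * b) powr t = (c powr (1 - t) * c powr t) * (a powr (1 - t) * b powr t)"
    using assms by (simp add: powr_mult)
  then show ?thesis using assms by (simp flip: powr_add)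
qed

lemma powr_product_mono:
  fixes a b a' b' t :: real
  assumes "0 \<le> a" "0 \<le> b" "a \<le> a'" "b \<le> b'" "0 < t" "t < 1"
  shows "a powr (1 - t) * b powr t \<le> a' powr (1 - t) * b' powr t"
  using assms by (intro mult_mono powr_mono2) auto

lemma power_powr_commute:
  fixes y r :: real
  assumes "0 \<le> y"
  shows "(y ^ n) powr r = (y powr r) ^ n"
  using assms by (induction n) (auto simp: powr_mult)

locale lattice_couple = X0: fatou_lattice M N0 + X1: fatou_lattice M N1
  for M :: "'a measure" and N0 N1 :: "('a \<Rightarrow> real) \<Rightarrow> ennreal"
begin

section \<open>Membership in a Calderon product: solidity, linearity, factorization\<close>

lemma lat_mem_calderon_iff:
  "lat_mem M (calderon M N0 N1 t) f \<longleftrightarrow> (\<exists>K>0. calderon_le M N0 N1 t K f)"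
proof
  assume f: "lat_mem M (calderon M N0 N1 t) f"
  then have [measurable]: "f \<in> borel_measurable M" by (simp add: lat_mem_def)
  obtain c f0 f1 where c: "c > 0" and [measurable]: "f0 \<in> borel_measurable M" "f1 \<in> borel_measurable M"
    and bd: "N0 f0 \<le> 1" "N1 f1 \<le> 1"
    and le: "AE x in M. \<bar>f x\<bar> \<le> c * \<bar>f0 x\<bar> powr (1 - t) * \<bar>f1 x\<bar> powr t"
    using f by (auto simp: lat_mem_def calderon_def Inf_less_iff)
  have "calderon_le M N0 N1 t c f"
  proof (rule calderon_leI[where a = "\<lambda>x. c * \<bar>f0 x\<bar>" and b = "\<lambda>x. c * \<bar>f1 x\<bar>"])
    show "N0 (\<lambda>x. c * \<bar>f0 x\<bar>) \<le> ennreal c"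
      using X0.norm_scale_le[of "\<lambda>x. \<bar>f0 x\<bar>" 1 c] bd c by (simp add: X0.norm_abs)
    show "N1 (\<lambda>x. c * \<bar>f1 x\<bar>) \<le> ennreal c"
      using X1.norm_scale_le[of "\<lambda>x. \<bar>f1 x\<bar>" 1 c] bd c by (simp add: X1.norm_abs)
    show "AE x in M. \<bar>f x\<bar> \<le> (c * \<bar>f0 x\<bar>) powr (1 - t) * (c * \<bar>f1 x\<bar>) powr t"
      using le c by (simp add: powr_product_scale mult.assoc)
  qed (use c in auto)
  then show "\<exists>K>0. calderon_le M N0 N1 t K f" using c by blast
next
  assume "\<exists>K>0. calderon_le M N0 N1 t K f"
  then obtain K a b where K: "0 < K" and [measurable]: "f \<in> borel_measurable M"
    "a \<in> borel_measurable M" "b \<in> borel_measurable M"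
    and nn: "\<And>x. 0 \<le> a x" "\<And>x. 0 \<le> b x" and bd: "N0 a \<le> ennreal K" "N1 b \<le> ennreal K"
    and le: "AE x in M. \<bar>f x\<bar> \<le> a x powr (1 - t) * b x powr t"
    unfolding calderon_le_def by blast
  let ?f0 = "\<lambda>x. 1 / K * a x" and ?f1 = "\<lambda>x. 1 / K * b x"
  have "N0 ?f0 \<le> 1" using X0.norm_scale_le[of a K "1 / K"] bd K by simp
  moreover have "N1 ?f1 \<le> 1" using X1.norm_scale_le[of b K "1 / K"] bd K by simp
  moreover have "K * \<bar>?f0 x\<bar> powr (1 - t) * \<bar>?f1 x\<bar> powr t = a x powr (1 - t) * b x powr t" for x
    using powr_product_scale[OF K, of "?f0 x" "?f1 x" t] K nn by (simp add: mult.assoc)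
  ultimately have "\<exists>f0 f1. f0 \<in> borel_measurable M \<and> f1 \<in> borel_measurable M \<and>
      N0 f0 \<le> 1 \<and> N1 f1 \<le> 1 \<and> (AE x in M. \<bar>f x\<bar> \<le> K * \<bar>f0 x\<bar> powr (1 - t) * \<bar>f1 x\<bar> powr t)"
    using le by (intro exI[of _ ?f0] exI[of _ ?f1]) simp
  then have "calderon M N0 N1 t f \<le> ennreal K"
    unfolding calderon_def using K by (auto intro!: Inf_lower)
  then show "lat_mem M (calderon M N0 N1 t) f"
    by (auto simp: lat_mem_def intro: le_less_trans)
qed

lemma calderon_le_dominated:
  assumes f: "calderon_le M N0 N1 t K f" and g: "g \<in> borel_measurable M" and K: "0 \<le> K" and c: "0 < c"
    and le: "AE x in M. \<bar>g x\<bar> \<le> c * \<bar>f x\<bar>"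
  shows "calderon_le M N0 N1 t (c * K) g"
proof -
  from f obtain a b where ab: "a \<in> borel_measurable M" "b \<in> borel_measurable M"
    and nn: "\<And>x. 0 \<le> a x" "\<And>x. 0 \<le> b x" and bd: "N0 a \<le> ennreal K" "N1 b \<le> ennreal K"
    and fle: "AE x in M. \<bar>f x\<bar> \<le> a x powr (1 - t) * b x powr t"
    unfolding calderon_le_def by blast
  show ?thesis
  proof (rule calderon_leI[where a = "\<lambda>x. c * a x" and b = "\<lambda>x. c * b x"])
    show "AE x in M. \<bar>g x\<bar> \<le> (c * a x) powr (1 - t) * (c * b x) powr t"
      using le fle
    proof eventually_elim
      case (elim x)
      then have "\<bar>g x\<bar> \<le> c * (a x powr (1 - t) * b x powr t)"
        using c by (meson mult_left_mono less_imp_le order_trans)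
      then show ?case using c nn by (simp add: powr_product_scale)
    qed
  qed (use ab nn bd c g K X0.norm_scale_le X1.norm_scale_le in auto)
qed

text \<open>Both summands lie below the one product with factors \<open>a + a'\<close> and
  \<open>b + b'\<close>; counting it twice gives the 2.\<close>

lemma calderon_le_add:
  assumes f: "calderon_le M N0 N1 t K f" and g: "calderon_le M N0 N1 t L g"
    and "0 \<le> K" "0 \<le> L" "0 < t" "t < 1"
  shows "calderon_le M N0 N1 t (2 * (K + L)) (\<lambda>x. f x + g x)"
proof -
  from f obtain a b where ab[measurable]: "f \<in> borel_measurable M" "a \<in> borel_measurable M" "b \<in> borel_measurable M"
    and nn: "\<And>x. 0 \<le> a x" "\<And>x. 0 \<le> b x" and bd: "N0 a \<le> ennreal K" "N1 b \<le> ennreal K"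
    and fle: "AE x in M. \<bar>f x\<bar> \<le> a x powr (1 - t) * b x powr t"
    unfolding calderon_le_def by blast
  from g obtain a' b' where ab'[measurable]: "g \<in> borel_measurable M" "a' \<in> borel_measurable M" "b' \<in> borel_measurable M"
    and nn': "\<And>x. 0 \<le> a' x" "\<And>x. 0 \<le> b' x" and bd': "N0 a' \<le> ennreal L" "N1 b' \<le> ennreal L"
    and gle: "AE x in M. \<bar>g x\<bar> \<le> a' x powr (1 - t) * b' x powr t"
    unfolding calderon_le_def by blast
  have "calderon_le M N0 N1 t (K + L) (\<lambda>x. (a x + a' x) powr (1 - t) * (b x + b' x) powr t)"
  proof (rule calderon_leI[where a = "\<lambda>x. a x + a' x" and b = "\<lambda>x. b x + b' x"])
    show "N0 (\<lambda>x. a x + a' x) \<le> ennreal (K + L)"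
      using assms bd bd' by (auto intro!: order_trans[OF X0.norm_triangle] add_mono)
    show "N1 (\<lambda>x. b x + b' x) \<le> ennreal (K + L)"
      using assms bd bd' by (auto intro!: order_trans[OF X1.norm_triangle] add_mono)
  qed (use nn nn' in auto)
  moreover have "AE x in M. \<bar>f x + g x\<bar> \<le> 2 * \<bar>(a x + a' x) powr (1 - t) * (b x + b' x) powr t\<bar>"
    using fle gle
  proof eventually_elim
    case (elim x)
    have "a x powr (1 - t) * b x powr t \<le> (a x + a' x) powr (1 - t) * (b x + b' x) powr t"
      "a' x powr (1 - t) * b' x powr t \<le> (a x + a' x) powr (1 - t) * (b x + b' x) powr t"
      using assms nn nn' by (auto intro!: powr_product_mono)
    then show ?case using elim by linarith
  qed
  ultimately show ?thesis using assms by (intro calderon_le_dominated) auto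
qed

lemma calderon_mem_dominated:
  assumes "lat_mem M (calderon M N0 N1 t) f" "g \<in> borel_measurable M" "AE x in M. \<bar>g x\<bar> \<le> c * \<bar>f x\<bar>"
  shows "lat_mem M (calderon M N0 N1 t) g"
proof -
  obtain K where K: "0 < K" "calderon_le M N0 N1 t K f" using assms by (auto simp: lat_mem_calderon_iff)
  \<comment> \<open>The constant \<open>c\<close> is arbitrary here, while
    \<open>calderon_le_dominated\<close> asks for a positive one.\<close>
  have "AE x in M. \<bar>g x\<bar> \<le> (\<bar>c\<bar> + 1) * \<bar>f x\<bar>"
    using assms(3) by eventually_elim (smt (verit) abs_ge_self mult_right_mono abs_ge_zero)
  then have "calderon_le M N0 N1 t ((\<bar>c\<bar> + 1) * K) g"
    using K assms by (intro calderon_le_dominated) auto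
  then show ?thesis using K by (auto simp: lat_mem_calderon_iff intro!: exI[of _ "(\<bar>c\<bar> + 1) * K"])
qed

lemma calderon_mem_lincomb:
  assumes "lat_mem M (calderon M N0 N1 t) f" "lat_mem M (calderon M N0 N1 t) g" "0 < t" "t < 1"
  shows "lat_mem M (calderon M N0 N1 t) (\<lambda>x. c * f x + d * g x)"
proof -
  have [measurable]: "f \<in> borel_measurable M" "g \<in> borel_measurable M"
    using assms by (auto simp: lat_mem_def)
  have "lat_mem M (calderon M N0 N1 t) (\<lambda>x. c * f x)"
    using assms(1) by (rule calderon_mem_dominated[where c = "\<bar>c\<bar>"]) (auto simp: abs_mult)
  moreover have "lat_mem M (calderon M N0 N1 t) (\<lambda>x. d * g x)"
    using assms(2) by (rule calderon_mem_dominated[where c = "\<bar>d\<bar>"]) (auto simp: abs_mult)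
  ultimately obtain K L where KL: "0 < K" "calderon_le M N0 N1 t K (\<lambda>x. c * f x)"
    "0 < L" "calderon_le M N0 N1 t L (\<lambda>x. d * g x)" unfolding lat_mem_calderon_iff by blast
  then have "calderon_le M N0 N1 t (2 * (K + L)) (\<lambda>x. c * f x + d * g x)"
    using assms by (intro calderon_le_add) auto
  then show ?thesis using KL by (auto simp: lat_mem_calderon_iff intro!: exI[of _ "2 * (K + L)"])
qed

lemma calderon_mem_product:
  assumes "lat_mem M N0 a" "lat_mem M N1 b" "\<And>x. 0 \<le> a x" "\<And>x. 0 \<le> b x"
  shows "lat_mem M (calderon M N0 N1 t) (\<lambda>x. a x powr (1 - t) * b x powr t)"
proof -
  have [measurable]: "a \<in> borel_measurable M" "b \<in> borel_measurable M"
    using assms by (auto simp: lat_mem_def)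
  obtain K L where KL: "0 < K" "N0 a \<le> ennreal K" "0 < L" "N1 b \<le> ennreal L"
    using X0.norm_bounded_obtain[OF assms(1)] X1.norm_bounded_obtain[OF assms(2)] by metis
  have "ennreal K \<le> ennreal (K + L)" "ennreal L \<le> ennreal (K + L)" using KL by (auto intro: ennreal_leI)
  then have "calderon_le M N0 N1 t (K + L) (\<lambda>x. a x powr (1 - t) * b x powr t)"
    using assms KL by (intro calderon_leI[where a = a and b = b]) (auto intro: order_trans)
  then show ?thesis using KL by (auto simp: lat_mem_calderon_iff intro!: exI[of _ "K + L"])
qed

lemma calderon_mem_obtain:
  assumes "lat_mem M (calderon M N0 N1 t) f"
  obtains a b where "lat_mem M N0 a" "lat_mem M N1 b" "\<And>x. 0 \<le> a x" "\<And>x. 0 \<le> b x"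
    "AE x in M. \<bar>f x\<bar> \<le> a x powr (1 - t) * b x powr t"
proof -
  obtain K where "calderon_le M N0 N1 t K f" using assms lat_mem_calderon_iff by blast
  then obtain a b where "a \<in> borel_measurable M" "b \<in> borel_measurable M" "\<And>x. 0 \<le> a x" "\<And>x. 0 \<le> b x"
    "N0 a \<le> ennreal K" "N1 b \<le> ennreal K" "AE x in M. \<bar>f x\<bar> \<le> a x powr (1 - t) * b x powr t"
    unfolding calderon_le_def by blast
  moreover have "lat_mem M N0 a" "lat_mem M N1 b"
    using calculation by (auto simp: lat_mem_def intro: le_less_trans)
  ultimately show ?thesis using that[of a b] by blast
qed

lemma calderon_weak_unit_obtain:
  obtains e where "lat_mem M (calderon M N0 N1 t) e" "\<And>x. 0 \<le> e x" "AE x in M. 0 < e x"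
proof -
  obtain w where w: "w \<in> borel_measurable M" "N0 w \<le> 1" "\<And>x. 0 \<le> w x" "AE x in M. 0 < w x"
    using X0.weak_unit_obtain by blast
  obtain v where v: "v \<in> borel_measurable M" "N1 v \<le> 1" "\<And>x. 0 \<le> v x" "AE x in M. 0 < v x"
    using X1.weak_unit_obtain by blast
  have "lat_mem M N0 w" "lat_mem M N1 v" using w v by (auto simp: lat_mem_def intro: le_less_trans)
  then have "lat_mem M (calderon M N0 N1 t) (\<lambda>x. w x powr (1 - t) * v x powr t)"
    using w v by (intro calderon_mem_product) auto
  moreover have "AE x in M. 0 < w x powr (1 - t) * v x powr t" using w(4) v(4) by eventually_elim simp
  ultimately show ?thesis by (intro that) auto
qed

section \<open>The sum space: solidity and linearity\<close>

lemma sum_mem_iff: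
  "sum_mem M N0 N1 f \<longleftrightarrow> f \<in> borel_measurable M \<and>
     (\<exists>a b. lat_mem M N0 a \<and> lat_mem M N1 b \<and> (\<forall>x. 0 \<le> a x) \<and> (\<forall>x. 0 \<le> b x) \<and>
        (AE x in M. \<bar>f x\<bar> \<le> a x + b x))"
proof
  assume "sum_mem M N0 N1 f"
  then obtain f0 f1 where f: "f \<in> borel_measurable M" "lat_mem M N0 f0" "lat_mem M N1 f1"
    "AE x in M. f x = f0 x + f1 x" unfolding sum_mem_def by blast
  then have "AE x in M. \<bar>f x\<bar> \<le> \<bar>f0 x\<bar> + \<bar>f1 x\<bar>" by (auto elim!: eventually_mono)
  then show "f \<in> borel_measurable M \<and> (\<exists>a b. lat_mem M N0 a \<and> lat_mem M N1 b \<and> (\<forall>x. 0 \<le> a x) \<and>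
      (\<forall>x. 0 \<le> b x) \<and> (AE x in M. \<bar>f x\<bar> \<le> a x + b x))"
    using f by (intro conjI exI[of _ "\<lambda>x. \<bar>f0 x\<bar>"] exI[of _ "\<lambda>x. \<bar>f1 x\<bar>"])
      (auto simp: lat_mem_def X0.norm_abs X1.norm_abs)
next
  assume R: "f \<in> borel_measurable M \<and> (\<exists>a b. lat_mem M N0 a \<and> lat_mem M N1 b \<and> (\<forall>x. 0 \<le> a x) \<and>
      (\<forall>x. 0 \<le> b x) \<and> (AE x in M. \<bar>f x\<bar> \<le> a x + b x))"
  then obtain a b where ab: "lat_mem M N0 a" "lat_mem M N1 b" "\<And>x. 0 \<le> a x" "\<And>x. 0 \<le> b x"
    "AE x in M. \<bar>f x\<bar> \<le> a x + b x" by blast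
  have [measurable]: "f \<in> borel_measurable M" "a \<in> borel_measurable M" "b \<in> borel_measurable M"
    using R ab by (auto simp: lat_mem_def)
  \<comment> \<open>Clipping \<open>f\<close> to the interval from \<open>- a\<close> to
    \<open>a\<close> leaves a remainder of size at most \<open>b\<close>, so the domination splits
    into a decomposition.\<close>
  define g where "g x = max (- a x) (min (a x) (f x))" for x
  have [measurable]: "g \<in> borel_measurable M" unfolding g_def by measurable
  have "N0 g \<le> N0 a" using ab(3) by (intro X0.norm_mono AE_I2) (auto simp: g_def abs_le_iff)
  moreover have "N1 (\<lambda>x. f x - g x) \<le> N1 b"
    using ab(5)
  proof (intro X1.norm_mono, goal_cases)
    case 3 then show ?case
    proof eventually_elim
      case (elim x) then show ?case using ab(3)[of x] ab(4)[of x] unfolding g_def by linarith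
    qed
  qed auto
  ultimately have "lat_mem M N0 g" "lat_mem M N1 (\<lambda>x. f x - g x)"
    using ab by (auto simp: lat_mem_def intro: le_less_trans)
  then show "sum_mem M N0 N1 f" unfolding sum_mem_def
    by (intro conjI exI[of _ g] exI[of _ "\<lambda>x. f x - g x"]) auto
qed

lemma sum_mem_dominated:
  assumes "sum_mem M N0 N1 f" "g \<in> borel_measurable M" "AE x in M. \<bar>g x\<bar> \<le> \<bar>f x\<bar>"
  shows "sum_mem M N0 N1 g"
proof -
  obtain a b where ab: "lat_mem M N0 a" "lat_mem M N1 b" "\<forall>x. 0 \<le> a x" "\<forall>x. 0 \<le> b x"
    "AE x in M. \<bar>f x\<bar> \<le> a x + b x" using assms(1) unfolding sum_mem_iff by blast
  have "AE x in M. \<bar>g x\<bar> \<le> a x + b x" using assms(3) ab(5) by eventually_elim simp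
  then show ?thesis unfolding sum_mem_iff using ab assms(2) by blast
qed

lemma sum_mem_lincomb:
  assumes "sum_mem M N0 N1 f" "sum_mem M N0 N1 g"
  shows "sum_mem M N0 N1 (\<lambda>x. c * f x + d * g x)"
proof -
  obtain f0 f1 where f: "f \<in> borel_measurable M" "lat_mem M N0 f0" "lat_mem M N1 f1"
    "AE x in M. f x = f0 x + f1 x" using assms unfolding sum_mem_def by blast
  obtain g0 g1 where g: "g \<in> borel_measurable M" "lat_mem M N0 g0" "lat_mem M N1 g1"
    "AE x in M. g x = g0 x + g1 x" using assms unfolding sum_mem_def by blast
  have [measurable]: "f0 \<in> borel_measurable M" "f1 \<in> borel_measurable M"
      "g0 \<in> borel_measurable M" "g1 \<in> borel_measurable M"
    using f g by (auto simp: lat_mem_def)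
  have "N0 (\<lambda>x. c * f0 x + d * g0 x) \<le> ennreal \<bar>c\<bar> * N0 f0 + ennreal \<bar>d\<bar> * N0 g0"
    using X0.norm_triangle[of "\<lambda>x. c * f0 x" "\<lambda>x. d * g0 x"] by (simp add: X0.norm_scale)
  also have "\<dots> < \<infinity>" using f g by (simp add: lat_mem_def ennreal_mult_less_top)
  finally have 0: "lat_mem M N0 (\<lambda>x. c * f0 x + d * g0 x)" by (simp add: lat_mem_def)
  have "N1 (\<lambda>x. c * f1 x + d * g1 x) \<le> ennreal \<bar>c\<bar> * N1 f1 + ennreal \<bar>d\<bar> * N1 g1"
    using X1.norm_triangle[of "\<lambda>x. c * f1 x" "\<lambda>x. d * g1 x"] by (simp add: X1.norm_scale)
  also have "\<dots> < \<infinity>" using f g by (simp add: lat_mem_def ennreal_mult_less_top)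
  finally have 1: "lat_mem M N1 (\<lambda>x. c * f1 x + d * g1 x)" by (simp add: lat_mem_def)
  have "AE x in M. c * f x + d * g x = (c * f0 x + d * g0 x) + (c * f1 x + d * g1 x)"
    using f(4) g(4) by eventually_elim (simp add: algebra_simps)
  moreover have "(\<lambda>x. c * f x + d * g x) \<in> borel_measurable M" using f(1) g(1) by measurable
  ultimately show ?thesis unfolding sum_mem_def using 0 1 by blast
qed

lemma sum_mem_of_mem0: "lat_mem M N0 f \<Longrightarrow> sum_mem M N0 N1 f"
  unfolding sum_mem_def
  by (intro conjI exI[of _ f] exI[of _ "\<lambda>_. 0"]) (auto simp: lat_mem_def X1.norm_eq_0_iff[THEN iffD2])

lemma sum_mem_of_mem1: "lat_mem M N1 f \<Longrightarrow> sum_mem M N0 N1 f"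
  unfolding sum_mem_def
  by (intro conjI exI[of _ f] exI[of _ "\<lambda>_. 0"]) (auto simp: lat_mem_def X0.norm_eq_0_iff[THEN iffD2])

lemma sum_mem_of_calderon_mem:
  assumes "lat_mem M (calderon M N0 N1 t) f" "0 < t" "t < 1"
  shows "sum_mem M N0 N1 f"
proof -
  obtain a b where ab: "lat_mem M N0 a" "lat_mem M N1 b" "\<And>x. 0 \<le> a x" "\<And>x. 0 \<le> b x"
    "AE x in M. \<bar>f x\<bar> \<le> a x powr (1 - t) * b x powr t" using calderon_mem_obtain[OF assms(1)] by blast
  have "a x powr (1 - t) * b x powr t \<le> a x + b x" for x
    using powr_product_le_sum[of "a x" "b x" 1 t] ab assms by simp
  then have "AE x in M. \<bar>f x\<bar> \<le> a x + b x" using ab(5) by (auto elim!: eventually_mono intro: order_trans)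
  then show ?thesis unfolding sum_mem_iff using ab assms(1) by (auto simp: lat_mem_def)
qed

text \<open>Each test of \<open>p\<close> against some \<open>v\<close> yields a new element of the
  unit ball of \<open>N1\<close> to test against next. In the product of these inequalities the
  intermediate elements cancel, and the factors on the \<open>N0\<close> side form a geometric mean.
  In the constant, one factor 2 comes from \<open>geometric_majorant\<close> and one from
  \<open>eventually_le_of_power_le\<close>; the exponent undoes the power \<open>1 - t\<close> of
  \<open>p\<close>.\<close>

lemma calderon_cancellation:
  assumes t: "0 < t" "t < 1" and C: "0 < C"
    and p[measurable]: "p \<in> borel_measurable M" and p0: "\<And>x. 0 \<le> p x"
    and H: "\<And>v. v \<in> borel_measurable M \<Longrightarrow> (\<And>x. 0 \<le> v x) \<Longrightarrow> N1 v \<le> 1 \<Longrightarrow>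
      calderon_le M N0 N1 t C (\<lambda>x. p x powr (1 - t) * v x powr t)"
  shows "N0 p \<le> ennreal ((4 * C) powr (1 / (1 - t)))"
proof -
  define ok where "ok v \<longleftrightarrow> v \<in> borel_measurable M \<and> (\<forall>x. 0 \<le> v x) \<and> N1 v \<le> 1" for v
  \<comment> \<open>Both factors are normalized to the unit balls, with \<open>C\<close> in front,
    so that \<open>w\<close> can take the place of \<open>v\<close>.\<close>
  define good where "good v u w \<longleftrightarrow> u \<in> borel_measurable M \<and> (\<forall>x. 0 \<le> u x) \<and> N0 u \<le> 1 \<and> ok w \<and>
    (AE x in M. p x powr (1 - t) * v x powr t \<le> C * (u x powr (1 - t) * w x powr t))" for v u w
  have "\<exists>u w. good v u w" if "ok v" for v
  proof -
    have "calderon_le M N0 N1 t C (\<lambda>x. p x powr (1 - t) * v x powr t)"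
      using H that unfolding ok_def by blast
    then obtain a b where [measurable]: "a \<in> borel_measurable M" "b \<in> borel_measurable M"
      and nn: "\<And>x. 0 \<le> a x" "\<And>x. 0 \<le> b x" and bd: "N0 a \<le> ennreal C" "N1 b \<le> ennreal C"
      and le: "AE x in M. \<bar>p x powr (1 - t) * v x powr t\<bar> \<le> a x powr (1 - t) * b x powr t"
      unfolding calderon_le_def by blast
    have "N0 (\<lambda>x. 1 / C * a x) \<le> 1" using X0.norm_scale_le[of a C "1 / C"] bd C by simp
    moreover have "N1 (\<lambda>x. 1 / C * b x) \<le> 1" using X1.norm_scale_le[of b C "1 / C"] bd C by simp
    moreover have "C * ((1 / C * a x) powr (1 - t) * (1 / C * b x) powr t) = a x powr (1 - t) * b x powr t" for x
      using powr_product_scale[OF C, of "1 / C * a x" "1 / C * b x" t] C nn by simp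
    ultimately have "good v (\<lambda>x. 1 / C * a x) (\<lambda>x. 1 / C * b x)"
      unfolding good_def ok_def using nn C le by auto
    then show ?thesis by blast
  qed
  then obtain U W where UW: "\<And>v. ok v \<Longrightarrow> good v (U v) (W v)" by metis
  obtain w where w: "w \<in> borel_measurable M" "N1 w \<le> 1" "\<And>x. 0 \<le> w x" "AE x in M. 0 < w x"
    using X1.weak_unit_obtain by blast
  \<comment> \<open>The orbit starts at a weak unit because the initial factor
    \<open>w powr t\<close> has to be positive a.e. when it is absorbed at the end.\<close>
  define v where "v n = (W ^^ n) w" for n
  define u where "u n = U (v n)" for n
  have v_ok: "ok (v n)" for n
    by (induction n) (use w UW in \<open>auto simp: v_def ok_def[of w] good_def\<close>)
  have v_Suc: "v (Suc n) = W (v n)" for n by (simp add: v_def)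
  have uv: "good (v n) (u n) (v (Suc n))" for n using UW[OF v_ok] by (simp add: u_def v_Suc)
  have [measurable]: "u n \<in> borel_measurable M" "v n \<in> borel_measurable M" for n
    using uv[of n] v_ok[of n] by (auto simp: good_def ok_def)
  have u0: "0 \<le> u n x" and v0: "0 \<le> v n x" and uN: "N0 (u n) \<le> 1" for n x
    using uv[of n] v_ok[of n] by (auto simp: good_def ok_def)
  \<comment> \<open>The last factor \<open>v n\<close> survives the cancellation and varies with
    \<open>n\<close>; it is replaced by the fixed \<open>V\<close> at the price of turning
    \<open>C\<close> into \<open>2 * C\<close>.\<close>
  obtain V where V: "V \<in> borel_measurable M" "\<And>x. 0 \<le> V x" "N1 V < \<infinity>"
      "AE x in M. \<forall>n. v n x \<le> 2 ^ n * V x"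
    by (rule X1.geometric_majorant[of v]) (use v_ok in \<open>auto simp: ok_def\<close>)
  \<comment> \<open>Arithmetic means replace geometric ones because the triangle inequality keeps
    them in the unit ball. Division by zero makes \<open>F 0 = 0\<close>.\<close>
  define F where "F n x = (\<Sum>i<n. u i x) / real n" for n x
  have [measurable]: "F n \<in> borel_measurable M" for n unfolding F_def by measurable
  have F0: "0 \<le> F n x" for n x using u0 by (simp add: F_def sum_nonneg)
  have FN: "N0 (F n) \<le> 1" for n
  proof -
    have "N0 (\<lambda>x. \<Sum>i<n. u i x) \<le> (\<Sum>i<n. N0 (u i))" by (rule X0.norm_sum) simp
    also have "\<dots> \<le> (\<Sum>i<n. 1)" using uN by (intro sum_mono)
    also have "\<dots> = ennreal (real n)" by (simp add: ennreal_of_nat_eq_real_of_nat)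
    finally have "N0 (\<lambda>x. 1 / real n * (\<Sum>i<n. u i x)) \<le> ennreal (1 / real n * real n)"
      by (intro X0.norm_scale_le) auto
    also have "\<dots> \<le> 1" by simp
    finally show ?thesis by (simp add: F_def[abs_def] divide_inverse mult.commute)
  qed
  define L where "L = (4 * C) powr (1 / (1 - t))"
  have "AE x in M. \<forall>n. p x powr (1 - t) * v n x powr t \<le> C * (u n x powr (1 - t) * v (Suc n) x powr t)"
    using uv by (simp add: AE_all_countable good_def)
  then have ev: "AE x in M. \<forall>\<^sub>F n in sequentially. p x \<le> L * F n x"
    using V(4) w(4)
  proof eventually_elim
    case (elim x)
    define P where "P = p x powr (1 - t)"
    have "0 \<le> P" by (simp add: P_def)
    \<comment> \<open>Telescoping: the element \<open>v (Suc n)\<close> produced by one inequality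
      is consumed by the next.\<close>
    have iter: "P ^ n * w x powr t \<le> C ^ n * (\<Prod>i<n. u i x) powr (1 - t) * v n x powr t" for n
    proof (induction n)
      case 0 then show ?case by (simp add: v_def)
    next
      case (Suc n)
      have pr: "0 \<le> (\<Prod>i<n. u i x)" using u0 by (simp add: prod_nonneg)
      have "P ^ Suc n * w x powr t \<le> P * (C ^ n * (\<Prod>i<n. u i x) powr (1 - t) * v n x powr t)"
        using mult_left_mono[OF Suc \<open>0 \<le> P\<close>] by (simp add: mult_ac)
      also have "\<dots> = C ^ n * (\<Prod>i<n. u i x) powr (1 - t) * (P * v n x powr t)" by (simp add: mult_ac)
      also have "\<dots> \<le> C ^ n * (\<Prod>i<n. u i x) powr (1 - t) * (C * (u n x powr (1 - t) * v (Suc n) x powr t))"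
        using elim(1) C unfolding P_def by (intro mult_left_mono) auto
      also have "\<dots> = C ^ Suc n * (\<Prod>i<Suc n. u i x) powr (1 - t) * v (Suc n) x powr t"
        using u0 pr by (simp add: powr_mult mult_ac)
      finally show ?case .
    qed
    have "\<forall>\<^sub>F n in sequentially. P \<le> 2 * (2 * C) * (F n x powr (1 - t))"
    proof (rule eventually_le_of_power_le[where a = "w x powr t" and b = "V x powr t"])
      show "P ^ n * w x powr t \<le> (2 * C) ^ n * (F n x powr (1 - t)) ^ n * V x powr t" for n
      proof -
        have "v n x powr t \<le> (2 ^ n * V x) powr t" using elim(2) v0 t by (intro powr_mono2) auto
        also have "\<dots> = (2 ^ n) powr t * V x powr t" using V by (simp add: powr_mult)
        also have "\<dots> \<le> 2 ^ n * V x powr t"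
          using t powr_mono[of t 1 "2 ^ n :: real"] by (intro mult_right_mono) auto
        finally have 1: "v n x powr t \<le> 2 ^ n * V x powr t" .
        have "(\<Prod>i<n. u i x) powr (1 - t) \<le> (F n x ^ n) powr (1 - t)"
          using prod_le_mean_power[of "\<lambda>i. u i x" n] u0 t
          by (intro powr_mono2) (auto simp: F_def prod_nonneg)
        also have "\<dots> = (F n x powr (1 - t)) ^ n"
          using F0[of n x] by (rule power_powr_commute)
        finally have 2: "(\<Prod>i<n. u i x) powr (1 - t) \<le> (F n x powr (1 - t)) ^ n" .
        have "C ^ n * (\<Prod>i<n. u i x) powr (1 - t) * v n x powr t
            \<le> C ^ n * (F n x powr (1 - t)) ^ n * (2 ^ n * V x powr t)"
          using 1 2 C by (intro mult_mono mult_left_mono) auto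
        then show ?thesis using iter[of n] by (simp add: power_mult_distrib mult_ac)
      qed
    qed (use C elim \<open>0 \<le> P\<close> in auto)
    then show ?case
    proof eventually_elim
      case (elim n)
      have "p x = P powr (1 / (1 - t))" unfolding P_def using p0 t by (simp add: powr_powr)
      also have "\<dots> \<le> (4 * C * F n x powr (1 - t)) powr (1 / (1 - t))"
        using elim \<open>0 \<le> P\<close> t by (intro powr_mono2) auto
      also have "\<dots> = L * F n x" unfolding L_def using C F0[of n x] t by (simp add: powr_mult powr_powr)
      finally show ?case .
    qed
  qed
  have L0: "0 \<le> L" by (simp add: L_def)
  have "N0 p \<le> ennreal L"
  \<comment> \<open>The means \<open>F n\<close> may fail to converge. So \<open>p\<close> is
    restricted to the set where the bound holds from index \<open>n\<close> on: this function is
    below \<open>L * F n\<close>, and it increases to \<open>p\<close> a.e.\<close>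
  proof (rule X0.norm_le_of_increasing[where s = "\<lambda>n x. if \<forall>m\<ge>n. p x \<le> L * F m x then p x else 0"])
    show "(\<lambda>x. if \<forall>m\<ge>n. p x \<le> L * F m x then p x else 0) \<in> borel_measurable M" for n
      by measurable
    show "N0 (\<lambda>x. if \<forall>m\<ge>n. p x \<le> L * F m x then p x else 0) \<le> ennreal L" for n
    proof -
      have "N0 (\<lambda>x. if \<forall>m\<ge>n. p x \<le> L * F m x then p x else 0) \<le> N0 (\<lambda>x. L * F n x)"
        using p0 F0 L0 by (intro X0.norm_mono) auto
      also have "\<dots> \<le> ennreal L" using X0.norm_scale_le[of "F n" 1 L] FN L0 by simp
      finally show ?thesis .
    qed
    show "AE x in M. (\<forall>n. 0 \<le> (if \<forall>m\<ge>n. p x \<le> L * F m x then p x else 0) \<and>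
        (if \<forall>m\<ge>n. p x \<le> L * F m x then p x else 0) \<le> (if \<forall>m\<ge>Suc n. p x \<le> L * F m x then p x else 0)) \<and>
        (\<lambda>n. if \<forall>m\<ge>n. p x \<le> L * F m x then p x else 0) \<longlonglongrightarrow> p x"
      using ev
    proof eventually_elim
      case (elim x)
      then obtain k where k: "\<And>m. m \<ge> k \<Longrightarrow> p x \<le> L * F m x" by (auto simp: eventually_sequentially)
      have "\<forall>\<^sub>F n in sequentially. (if \<forall>m\<ge>n. p x \<le> L * F m x then p x else 0) = p x"
        using eventually_ge_at_top[of k] by eventually_elim (use k in auto)
      then have "(\<lambda>n. if \<forall>m\<ge>n. p x \<le> L * F m x then p x else 0) \<longlonglongrightarrow> p x" by (rule tendsto_eventually)
      then show ?case using p0 by (auto dest: Suc_leD)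
    qed
  qed simp
  then show ?thesis by (simp add: L_def)
qed

end

section \<open>Positive operators on couples\<close>

locale positive_couple_operator =
  X: lattice_couple M NX0 NX1 + Y: lattice_couple M' NY0 NY1
  for M :: "'a measure" and NX0 NX1 :: "('a \<Rightarrow> real) \<Rightarrow> ennreal"
    and M' :: "'b measure" and NY0 NY1 :: "('b \<Rightarrow> real) \<Rightarrow> ennreal" +
  fixes T :: "('a \<Rightarrow> real) \<Rightarrow> ('b \<Rightarrow> real)"
  assumes positive: "positive_operator M NX0 NX1 M' NY0 NY1 T"
begin

abbreviation "Dom \<equiv> sum_mem M NX0 NX1"
abbreviation "Z t \<equiv> lat_mem M (calderon M NX0 NX1 t)"
abbreviation "W t \<equiv> lat_mem M' (calderon M' NY0 NY1 t)"

section \<open>Rules for \<open>T\<close> on the sum space\<close>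

lemma T_measurable[measurable (raw)]: "Dom f \<Longrightarrow> T f \<in> borel_measurable M'"
  using positive unfolding positive_operator_def by blast

lemma T_cong: "Dom f \<Longrightarrow> Dom g \<Longrightarrow> AE x in M. f x = g x \<Longrightarrow> AE y in M'. T f y = T g y"
  using positive unfolding positive_operator_def by blast

lemma T_lincomb:
  "Dom f \<Longrightarrow> Dom g \<Longrightarrow> AE y in M'. T (\<lambda>x. a * f x + b * g x) y = a * T f y + b * T g y"
  using positive unfolding positive_operator_def by blast

lemma T_nonneg: "Dom f \<Longrightarrow> AE x in M. 0 \<le> f x \<Longrightarrow> AE y in M'. 0 \<le> T f y"
  using positive unfolding positive_operator_def by blast

lemma T_bounded0: obtains C where "0 \<le> C" "\<And>f. lat_mem M NX0 f \<Longrightarrow> NY0 (T f) \<le> ennreal C * NX0 f"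
  using positive unfolding positive_operator_def by blast

lemma T_bounded1: obtains C where "0 \<le> C" "\<And>f. lat_mem M NX1 f \<Longrightarrow> NY1 (T f) \<le> ennreal C * NX1 f"
  using positive unfolding positive_operator_def by blast

lemma T_scale:
  assumes "Dom f"
  shows "AE y in M'. T (\<lambda>x. a * f x) y = a * T f y"
  using T_lincomb[OF assms assms, of a 0] by simp

lemma T_diff:
  assumes "Dom f" "Dom g"
  shows "Dom (\<lambda>x. f x - g x)" "AE y in M'. T (\<lambda>x. f x - g x) y = T f y - T g y"
  using X.sum_mem_lincomb[OF assms, of 1 "-1"] T_lincomb[OF assms, of 1 "-1"] by simp_all

lemma T_mono:
  assumes "Dom f" "Dom g" "AE x in M. f x \<le> g x"
  shows "AE y in M'. T f y \<le> T g y"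
proof -
  have "AE y in M'. 0 \<le> T (\<lambda>x. g x - f x) y"
    using assms by (intro T_nonneg T_diff) auto
  then show ?thesis using T_diff(2)[OF assms(2,1)] by eventually_elim simp
qed

lemma T_abs_le:
  assumes "Dom f" "Dom g" "AE x in M. \<bar>f x\<bar> \<le> g x"
  shows "AE y in M'. \<bar>T f y\<bar> \<le> T g y"
proof -
  have "AE y in M'. T f y \<le> T g y" using assms by (intro T_mono) (auto elim!: eventually_mono)
  moreover have "AE y in M'. T (\<lambda>x. (- 1) * f x) y \<le> T g y"
    using assms X.sum_mem_lincomb[OF assms(1,1), of "-1" 0]
    by (intro T_mono) (auto elim!: eventually_mono)
  moreover note T_scale[OF assms(1), of "- 1"]
  ultimately show ?thesis by eventually_elim simp
qed

text \<open>The majorants \<open>s powr t * a + s powr (t - 1) * b\<close> are linear in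
  \<open>a\<close> and \<open>b\<close>, so \<open>T\<close> passes through each of them; testing
  all rational \<open>s\<close> recovers the product up to the factor 3.\<close>

lemma T_calderon_le:
  assumes "Dom f" "Dom a" "Dom b" "\<And>x. 0 \<le> a x" "\<And>x. 0 \<le> b x" "0 < t" "t < 1"
    and le: "AE x in M. \<bar>f x\<bar> \<le> a x powr (1 - t) * b x powr t"
  shows "AE y in M'. \<bar>T f y\<bar> \<le> 3 * (T a y powr (1 - t) * T b y powr t)"
proof -
  have "AE y in M'. \<bar>T f y\<bar> \<le> s powr t * T a y + s powr (t - 1) * T b y" if "0 < s" for s
  proof -
    have "AE x in M. \<bar>f x\<bar> \<le> s powr t * a x + s powr (t - 1) * b x"
      using le powr_product_le_sum[OF assms(4,5) that assms(6,7)]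
      by (auto elim!: eventually_mono intro: order_trans)
    then have "AE y in M'. \<bar>T f y\<bar> \<le> T (\<lambda>x. s powr t * a x + s powr (t - 1) * b x) y"
      using assms by (intro T_abs_le X.sum_mem_lincomb)
    then show ?thesis using T_lincomb[OF assms(2,3), of "s powr t" "s powr (t - 1)"]
      by eventually_elim simp
  qed
  then have "AE y in M'. \<forall>s\<in>\<rat>. 0 < s \<longrightarrow> \<bar>T f y\<bar> \<le> s powr t * T a y + s powr (t - 1) * T b y"
    by (subst AE_ball_countable) (auto simp: countable_rat)
  moreover have "AE y in M'. 0 \<le> T a y" "AE y in M'. 0 \<le> T b y" using assms by (auto intro: T_nonneg)
  ultimately show ?thesis
    by eventually_elim (use assms in \<open>auto intro!: le_powr_product_of_le_sums\<close>)
qed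

lemma T_mem0: assumes "lat_mem M NX0 a" shows "lat_mem M' NY0 (T a)"
proof -
  obtain C where "0 \<le> C" "NY0 (T a) \<le> ennreal C * NX0 a" using T_bounded0 assms by blast
  moreover have "ennreal C * NX0 a < \<infinity>" using assms by (simp add: lat_mem_def ennreal_mult_less_top)
  ultimately show ?thesis
    using assms X.sum_mem_of_mem0 T_measurable unfolding lat_mem_def by (auto intro: le_less_trans)
qed

lemma T_mem1: assumes "lat_mem M NX1 a" shows "lat_mem M' NY1 (T a)"
proof -
  obtain C where "0 \<le> C" "NY1 (T a) \<le> ennreal C * NX1 a" using T_bounded1 assms by blast
  moreover have "ennreal C * NX1 a < \<infinity>" using assms by (simp add: lat_mem_def ennreal_mult_less_top)
  ultimately show ?thesis
    using assms X.sum_mem_of_mem1 T_measurable unfolding lat_mem_def by (auto intro: le_less_trans)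
qed

lemma T_calderon_mem:
  assumes "Z t f" "0 < t" "t < 1"
  shows "W t (T f)"
proof -
  obtain a b where ab: "lat_mem M NX0 a" "lat_mem M NX1 b" "\<And>x. 0 \<le> a x" "\<And>x. 0 \<le> b x"
    "AE x in M. \<bar>f x\<bar> \<le> a x powr (1 - t) * b x powr t" using X.calderon_mem_obtain[OF assms(1)] by blast
  have D: "Dom f" "Dom a" "Dom b"
    using assms ab X.sum_mem_of_calderon_mem X.sum_mem_of_mem0 X.sum_mem_of_mem1 by auto
  \<comment> \<open>\<open>T a\<close> and \<open>T b\<close> are nonnegative only a.e.; absolute
    values make them admissible factors everywhere.\<close>
  have "lat_mem M' NY0 (\<lambda>y. \<bar>T a y\<bar>)" "lat_mem M' NY1 (\<lambda>y. \<bar>T b y\<bar>)"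
    using T_mem0[OF ab(1)] T_mem1[OF ab(2)] by (auto simp: lat_mem_def Y.X0.norm_abs Y.X1.norm_abs)
  then have "W t (\<lambda>y. \<bar>T a y\<bar> powr (1 - t) * \<bar>T b y\<bar> powr t)"
    by (rule Y.calderon_mem_product) auto
  moreover have "AE y in M'. \<bar>T f y\<bar> \<le> 3 * \<bar>\<bar>T a y\<bar> powr (1 - t) * \<bar>T b y\<bar> powr t\<bar>"
    using T_calderon_le[OF D ab(3,4) assms(2,3) ab(5)]
      T_nonneg[OF D(2) AE_I2[OF ab(3)]] T_nonneg[OF D(3) AE_I2[OF ab(4)]]
    by eventually_elim (simp add: abs_mult)
  ultimately show ?thesis using D by (intro Y.calderon_mem_dominated[where g = "T f"]) auto
qed

text \<open>Every element of one Calderon product is approximated, on sets where the two factors are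
  comparable, by elements of any other; the error is relatively uniformly small in the sum space,
  so that no order continuity of \<open>T\<close> is needed.\<close>

lemma calderon_truncation:
  assumes f: "Z t f" and t: "0 < t" "t < 1" and s: "0 < s" "s < 1"
  obtains A :: "nat \<Rightarrow> 'a set" where "\<And>n. A n \<in> sets M" "incseq A"
    "AE x in M. f x \<noteq> 0 \<longrightarrow> (\<exists>n. x \<in> A n)"
    "\<And>n g. g \<in> borel_measurable M \<Longrightarrow> AE x in M. \<bar>g x\<bar> \<le> \<bar>f x\<bar> \<Longrightarrow> Z s (\<lambda>x. g x * indicator (A n) x)"
    "AE y in M'. (\<lambda>n. T (\<lambda>x. \<bar>f x\<bar> * indicator (- A n) x) y) \<longlonglongrightarrow> 0"
    "\<And>g. g \<in> borel_measurable M \<Longrightarrow> AE x in M. \<bar>g x\<bar> \<le> \<bar>f x\<bar> \<Longrightarrow>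
       AE y in M'. (\<lambda>n. T (\<lambda>x. g x * indicator (A n) x) y) \<longlonglongrightarrow> T g y"
proof -
  obtain a b where ab: "lat_mem M NX0 a" "lat_mem M NX1 b" "\<And>x. 0 \<le> a x" "\<And>x. 0 \<le> b x"
    and fle: "AE x in M. \<bar>f x\<bar> \<le> a x powr (1 - t) * b x powr t" using X.calderon_mem_obtain[OF f] by blast
  have [measurable]: "f \<in> borel_measurable M" "a \<in> borel_measurable M" "b \<in> borel_measurable M"
    using f ab by (auto simp: lat_mem_def)
  have D: "Dom f" "Dom a" "Dom b"
    using f t ab X.sum_mem_of_calderon_mem X.sum_mem_of_mem0 X.sum_mem_of_mem1 by auto
  \<comment> \<open>On \<open>A n\<close> the factors are comparable up to \<open>n + 1\<close>,
    which makes Calderon products with different exponents comparable. The sets miss only points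
    where one factor vanishes, and there \<open>f\<close> is 0 a.e.\<close>
  define A where "A n = {x \<in> space M. a x \<le> real (Suc n) * b x \<and> b x \<le> real (Suc n) * a x}" for n
  have A[measurable]: "A n \<in> sets M" for n unfolding A_def by measurable
  have "A n \<subseteq> A (Suc n)" for n
  proof
    fix x assume "x \<in> A n"
    moreover have "real (Suc n) * b x \<le> real (Suc (Suc n)) * b x" "real (Suc n) * a x \<le> real (Suc (Suc n)) * a x"
      using ab by (auto intro!: mult_right_mono)
    ultimately show "x \<in> A (Suc n)" unfolding A_def by auto
  qed
  then have incA: "incseq A" by (rule incseq_SucI)
  have cover: "AE x in M. f x \<noteq> 0 \<longrightarrow> (\<exists>n. x \<in> A n)"
    using fle AE_space
  proof eventually_elim
    case (elim x)
    show ?case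
    proof
      assume "f x \<noteq> 0"
      then have "a x \<noteq> 0" "b x \<noteq> 0" using elim by auto
      then have pos: "0 < a x" "0 < b x" using ab by (auto simp: less_le)
      obtain n :: nat where "max (a x / b x) (b x / a x) \<le> real n" using real_arch_simple by blast
      then have "a x / b x \<le> real (Suc n)" "b x / a x \<le> real (Suc n)" by auto
      then have "x \<in> A n" using pos elim by (simp add: A_def divide_le_eq)
      then show "\<exists>n. x \<in> A n" ..
    qed
  qed
  have memZ: "Z s (\<lambda>x. g x * indicator (A n) x)"
    if [measurable]: "g \<in> borel_measurable M" and gle: "AE x in M. \<bar>g x\<bar> \<le> \<bar>f x\<bar>" for g n
  proof (rule X.calderon_mem_dominated[where c = "real (Suc n)", OF X.calderon_mem_product[OF ab]])
    show "AE x in M. \<bar>g x * indicator (A n) x\<bar> \<le> real (Suc n) * \<bar>a x powr (1 - s) * b x powr s\<bar>"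
      using gle fle
    proof eventually_elim
      case (elim x)
      show ?case
      proof (cases "x \<in> A n")
        case True
        let ?m = "max (a x) (b x)" and ?l = "min (a x) (b x)"
        have self: "z powr (1 - r) * z powr r = z" if "0 \<le> z" for z r :: real
          using that by (simp flip: powr_add)
        have nn: "0 \<le> ?m" "0 \<le> ?l" using ab(3)[of x] ab(4)[of x] by auto
        \<comment> \<open>A weighted geometric mean with any exponent lies between minimum and
          maximum, and on \<open>A n\<close> these differ by a factor of at most
          \<open>n + 1\<close>.\<close>
        have "a x powr (1 - t) * b x powr t \<le> ?m powr (1 - t) * ?m powr t"
          using ab t by (intro powr_product_mono) auto
        also have "\<dots> = ?m" using nn(1) by (rule self)
        also have "\<dots> \<le> real (Suc n) * ?l"
        proof -
          have "1 * a x \<le> real (Suc n) * a x" "1 * b x \<le> real (Suc n) * b x"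
            using ab by (intro mult_right_mono; simp)+
          then show ?thesis using True by (auto simp: A_def min_def max_def)
        qed
        also have "?l = ?l powr (1 - s) * ?l powr s" using self[OF nn(2)] by simp
        also have "\<dots> \<le> a x powr (1 - s) * b x powr s"
          using ab s nn by (intro powr_product_mono) auto
        finally show ?thesis using elim True by (simp add: mult_left_mono)
      qed simp
    qed
  qed measurable
  \<comment> \<open>Off \<open>A n\<close> one factor is less than \<open>1 / (n + 1)\<close> times
    the other, so the product is at most \<open>(n + 1) powr (- t) * a\<close> or
    \<open>(n + 1) powr (t - 1) * b\<close>. The sum of the two coefficients covers both
    cases.\<close>
  define c where "c n = real (Suc n) powr (t - 1) + real (Suc n) powr (- t)" for n
  have c0: "0 \<le> c n" for n by (simp add: c_def)
  have "c \<longlonglongrightarrow> 0 + 0" unfolding c_def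
    using t by (intro tendsto_add tendsto_neg_powr filterlim_compose[OF filterlim_real_sequentially filterlim_Suc]) auto
  then have c_lim: "c \<longlonglongrightarrow> 0" by simp
  have off: "a x powr (1 - t) * b x powr t \<le> c n * a x + c n * b x" if x: "x \<in> space M" "x \<notin> A n" for x n
  proof -
    let ?N = "real (Suc n)"
    consider "?N * b x < a x" | "?N * a x < b x" using x by (force simp: A_def)
    then show ?thesis
    proof cases
      case 1
      then have "b x \<le> 1 / ?N * a x" by (simp add: field_simps)
      then have "a x powr (1 - t) * b x powr t \<le> a x powr (1 - t) * (1 / ?N * a x) powr t"
        using ab t by (intro mult_left_mono powr_mono2) auto
      also have "\<dots> = ?N powr (- t) * (a x powr (1 - t) * a x powr t)"
        using ab(3)[of x] by (simp add: powr_mult powr_divide powr_minus_divide)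
      also have "\<dots> = ?N powr (- t) * a x" using ab(3)[of x] by (simp flip: powr_add)
      also have "\<dots> \<le> c n * a x" using ab(3)[of x] by (intro mult_right_mono) (auto simp: c_def)
      finally show ?thesis using c0[of n] ab(4)[of x] by (smt (verit) mult_nonneg_nonneg)
    next
      case 2
      then have "a x \<le> 1 / ?N * b x" by (simp add: field_simps)
      then have "a x powr (1 - t) * b x powr t \<le> (1 / ?N * b x) powr (1 - t) * b x powr t"
        using ab t by (intro mult_right_mono powr_mono2) auto
      also have "\<dots> = ?N powr (t - 1) * (b x powr (1 - t) * b x powr t)"
        using ab(4)[of x] by (simp add: powr_mult powr_divide powr_minus_divide powr_diff)
      also have "\<dots> = ?N powr (t - 1) * b x" using ab(4)[of x] by (simp flip: powr_add)
      also have "\<dots> \<le> c n * b x" using ab(4)[of x] by (intro mult_right_mono) (auto simp: c_def)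
      finally show ?thesis using c0[of n] ab(3)[of x] by (smt (verit) mult_nonneg_nonneg)
    qed
  qed
  \<comment> \<open>\<open>- A n\<close> is the complement in the whole type and may fail to be in
    \<open>sets M\<close>; its indicator is still measurable, being 1 minus that of
    \<open>A n\<close>.\<close>
  have Dind: "Dom (\<lambda>x. g x * indicator B x)"
    if "Dom g" "B \<in> sets M \<or> - B \<in> sets M" for g B
  proof -
    have [measurable]: "g \<in> borel_measurable M" using that by (simp add: sum_mem_def)
    have "(\<lambda>x. g x * indicator B x) \<in> borel_measurable M"
      using that(2)
    proof
      assume [measurable]: "- B \<in> sets M"
      have "(\<lambda>x. g x * (1 - indicator (- B) x)) \<in> borel_measurable M" by measurable
      also have "(\<lambda>x. g x * (1 - indicator (- B) x)) = (\<lambda>x. g x * indicator B x)"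
        by (auto simp: indicator_def)
      finally show ?thesis .
    next
      assume [measurable]: "B \<in> sets M"
      show ?thesis by measurable
    qed
    then show ?thesis by (rule X.sum_mem_dominated[OF that(1)]) (auto simp: indicator_def)
  qed
  have Dabs: "Dom (\<lambda>x. \<bar>f x\<bar>)" using D(1) by (rule X.sum_mem_dominated) auto
  \<comment> \<open>The error is a null sequence times one fixed function, so positivity alone
    yields pointwise convergence a.e.\<close>
  have small: "AE y in M'. \<forall>n. \<bar>T (\<lambda>x. \<bar>f x\<bar> * indicator (- A n) x) y\<bar> \<le> c n * (T a y + T b y)"
    unfolding AE_all_countable
  proof
    fix n
    have "AE x in M. \<bar>\<bar>f x\<bar> * indicator (- A n) x\<bar> \<le> c n * a x + c n * b x"
      using fle AE_space
    proof eventually_elim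
      case (elim x)
      have "0 \<le> c n * a x + c n * b x" using c0[of n] ab by (intro add_nonneg_nonneg mult_nonneg_nonneg) auto
      then show ?case using off[of x n] elim by (cases "x \<in> A n") auto
    qed
    then have "AE y in M'. \<bar>T (\<lambda>x. \<bar>f x\<bar> * indicator (- A n) x) y\<bar> \<le> T (\<lambda>x. c n * a x + c n * b x) y"
      using D A by (intro T_abs_le Dind X.sum_mem_lincomb Dabs) auto
    then show "AE y in M'. \<bar>T (\<lambda>x. \<bar>f x\<bar> * indicator (- A n) x) y\<bar> \<le> c n * (T a y + T b y)"
      using T_lincomb[OF D(2,3), of "c n" "c n"] by eventually_elim (simp add: algebra_simps)
  qed
  then have small0: "AE y in M'. (\<lambda>n. T (\<lambda>x. \<bar>f x\<bar> * indicator (- A n) x) y) \<longlonglongrightarrow> 0"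
  proof eventually_elim
    case (elim y)
    have "(\<lambda>n. c n * (T a y + T b y)) \<longlonglongrightarrow> 0 * (T a y + T b y)"
      using c_lim by (intro tendsto_mult_right)
    then have "(\<lambda>n. c n * (T a y + T b y)) \<longlonglongrightarrow> 0" by simp
    then show ?case by (rule Lim_null_comparison[rotated]) (use elim in auto)
  qed
  have approx: "AE y in M'. (\<lambda>n. T (\<lambda>x. g x * indicator (A n) x) y) \<longlonglongrightarrow> T g y"
    if g: "g \<in> borel_measurable M" and gle: "AE x in M. \<bar>g x\<bar> \<le> \<bar>f x\<bar>" for g
  proof -
    have Dg: "Dom g" using D(1) g gle by (rule X.sum_mem_dominated)
    have "AE y in M'. \<forall>n. \<bar>T (\<lambda>x. g x * indicator (A n) x) y - T g y\<bar>
        \<le> T (\<lambda>x. \<bar>f x\<bar> * indicator (- A n) x) y"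
      unfolding AE_all_countable
    proof
      fix n
      have DA: "Dom (\<lambda>x. g x * indicator (A n) x)" using Dg A by (intro Dind) auto
      have "AE y in M'. \<bar>T (\<lambda>x. g x * indicator (A n) x - g x) y\<bar> \<le> T (\<lambda>x. \<bar>f x\<bar> * indicator (- A n) x) y"
      proof (intro T_abs_le T_diff DA Dg Dind Dabs)
        show "AE x in M. \<bar>g x * indicator (A n) x - g x\<bar> \<le> \<bar>f x\<bar> * indicator (- A n) x"
          using gle by eventually_elim (auto simp: indicator_def)
      qed (use A in auto)
      then show "AE y in M'. \<bar>T (\<lambda>x. g x * indicator (A n) x) y - T g y\<bar>
          \<le> T (\<lambda>x. \<bar>f x\<bar> * indicator (- A n) x) y"
        using T_diff(2)[OF DA Dg] by eventually_elim simp
    qed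
    with small0 show ?thesis
    proof eventually_elim
      case (elim y)
      have "(\<lambda>n. T (\<lambda>x. g x * indicator (A n) x) y - T g y) \<longlonglongrightarrow> 0"
        using elim(1) by (rule Lim_null_comparison[rotated]) (use elim(2) in auto)
      then show ?case by (rule LIM_zero_cancel)
    qed
  qed
  show ?thesis by (rule that[OF A incA cover memZ small0 approx])
qed

end

section \<open>Boundedness of the inverse at the end points\<close>

locale calderon_isomorphism = positive_couple_operator M NX0 NX1 M' NY0 NY1 T
  for M :: "'a measure" and NX0 NX1 :: "('a \<Rightarrow> real) \<Rightarrow> ennreal"
    and M' :: "'b measure" and NY0 NY1 :: "('b \<Rightarrow> real) \<Rightarrow> ennreal"
    and T :: "('a \<Rightarrow> real) \<Rightarrow> ('b \<Rightarrow> real)" +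
  fixes \<theta> :: real
  assumes \<theta>: "0 < \<theta>" "\<theta> < 1"
    and iso: "order_isomorphism M (calderon M NX0 NX1 \<theta>) M' (calderon M' NY0 NY1 \<theta>) T"
begin

lemma Dom_of_Z: "Z \<theta> f \<Longrightarrow> Dom f"
  using X.sum_mem_of_calderon_mem \<theta> by blast

lemma iso_reflects_le:
  assumes "Z \<theta> f" "Z \<theta> g" "AE y in M'. T f y \<le> T g y"
  shows "AE x in M. f x \<le> g x"
proof -
  have "AE y in M'. 0 \<le> T (\<lambda>x. g x - f x) y"
    using T_diff(2)[OF Dom_of_Z[OF assms(2)] Dom_of_Z[OF assms(1)]] assms(3) by eventually_elim simp
  moreover have "Z \<theta> (\<lambda>x. g x - f x)"
    using X.calderon_mem_lincomb[OF assms(2,1) \<theta>, of 1 "-1"] by simp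
  ultimately have "AE x in M. 0 \<le> g x - f x" using iso unfolding order_isomorphism_def by blast
  then show ?thesis by eventually_elim simp
qed

lemma iso_preimage_nonneg:
  assumes "W \<theta> g" "AE y in M'. 0 \<le> g y"
  obtains f where "Z \<theta> f" "\<And>x. 0 \<le> f x" "AE y in M'. T f y = g y"
proof -
  obtain f where f: "Z \<theta> f" "AE y in M'. T f y = g y"
    using iso assms(1) unfolding order_isomorphism_def by blast
  have "AE y in M'. 0 \<le> T f y" using f(2) assms(2) by eventually_elim simp
  then have nn: "AE x in M. 0 \<le> f x" using iso f(1) unfolding order_isomorphism_def by blast
  have "f \<in> borel_measurable M" using f(1) by (simp add: lat_mem_def)
  \<comment> \<open>Passing to \<open>\<bar>f\<bar>\<close> changes \<open>f\<close> on a null set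
    only and makes it nonnegative everywhere.\<close>
  then have Z': "Z \<theta> (\<lambda>x. \<bar>f x\<bar>)"
    by (intro X.calderon_mem_dominated[OF f(1), where c = 1]) auto
  have "AE y in M'. T (\<lambda>x. \<bar>f x\<bar>) y = T f y"
    using nn by (intro T_cong Dom_of_Z Z' f(1)) (auto elim!: eventually_mono)
  then have "AE y in M'. T (\<lambda>x. \<bar>f x\<bar>) y = g y" using f(2) by eventually_elim simp
  then show ?thesis using that[OF Z'] by simp
qed

text \<open>Automatic boundedness of a positive operator, here the inverse. If it failed, images in
  the unit ball with ever larger preimages could be put under multiples \<open>2 ^ n * H\<close> of
  one element, and the preimage of \<open>H\<close> would bound all of these preimages.\<close>

lemma iso_inverse_bounded:
  obtains C where "0 < C" "\<And>f. Z \<theta> f \<Longrightarrow> (\<And>x. 0 \<le> f x) \<Longrightarrow>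
    calderon_le M' NY0 NY1 \<theta> 1 (T f) \<Longrightarrow> calderon_le M NX0 NX1 \<theta> C f"
proof (rule ccontr)
  assume "\<not> thesis"
  \<comment> \<open>In \<open>4 ^ n = 2 ^ n * 2 ^ n\<close> one factor pays for the geometric
    majorants and the other outgrows the bound \<open>K\<close> of the preimage of
    \<open>H\<close>.\<close>
  then have "\<exists>f. Z \<theta> f \<and> (\<forall>x. 0 \<le> f x) \<and> calderon_le M' NY0 NY1 \<theta> 1 (T f) \<and> \<not> calderon_le M NX0 NX1 \<theta> (4 ^ n) f"
    for n :: nat using that[of "4 ^ n"] by fastforce
  then obtain f where f: "\<And>n. Z \<theta> (f n)" "\<And>n x. 0 \<le> f n x" "\<And>n. calderon_le M' NY0 NY1 \<theta> 1 (T (f n))"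
    and large: "\<And>n::nat. \<not> calderon_le M NX0 NX1 \<theta> (4 ^ n) (f n)" by metis
  define good where "good n a b \<longleftrightarrow> a \<in> borel_measurable M' \<and> b \<in> borel_measurable M' \<and>
      (\<forall>x. 0 \<le> a x) \<and> (\<forall>x. 0 \<le> b x) \<and> NY0 a \<le> 1 \<and> NY1 b \<le> 1 \<and>
      (AE y in M'. \<bar>T (f n) y\<bar> \<le> a y powr (1 - \<theta>) * b y powr \<theta>)" for n a b
  have "\<exists>a b. good n a b" for n
    using f(3)[of n] unfolding calderon_le_def good_def by simp
  then obtain a b where good: "\<And>n. good n (a n) (b n)" by metis
  have ab: "\<And>n. a n \<in> borel_measurable M'" "\<And>n. b n \<in> borel_measurable M'"
      "\<And>n x. 0 \<le> a n x" "\<And>n x. 0 \<le> b n x" "\<And>n. NY0 (a n) \<le> 1" "\<And>n. NY1 (b n) \<le> 1"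
    and Tf: "\<And>n. AE y in M'. \<bar>T (f n) y\<bar> \<le> a n y powr (1 - \<theta>) * b n y powr \<theta>"
    using good unfolding good_def by blast+
  obtain A where A: "A \<in> borel_measurable M'" "\<And>x. 0 \<le> A x" "NY0 A < \<infinity>"
    "AE y in M'. \<forall>n. a n y \<le> 2 ^ n * A y"
    by (rule Y.X0.geometric_majorant[of a]) (use ab in auto)
  obtain B where B: "B \<in> borel_measurable M'" "\<And>x. 0 \<le> B x" "NY1 B < \<infinity>"
    "AE y in M'. \<forall>n. b n y \<le> 2 ^ n * B y"
    by (rule Y.X1.geometric_majorant[of b]) (use ab in auto)
  define H where "H y = A y powr (1 - \<theta>) * B y powr \<theta>" for y
  have "W \<theta> H" unfolding H_def using A B by (intro Y.calderon_mem_product) (auto simp: lat_mem_def)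
  then obtain k where k: "Z \<theta> k" "\<And>x. 0 \<le> k x" "AE y in M'. T k y = H y"
    by (rule iso_preimage_nonneg) (auto simp: H_def)
  obtain K where K: "0 < K" "calderon_le M NX0 NX1 \<theta> K k" using k(1) X.lat_mem_calderon_iff by blast
  obtain n where n: "K < 2 ^ n" using real_arch_pow[of 2 K] by auto
  have Zk: "Z \<theta> (\<lambda>x. 2 ^ n * k x)" using X.calderon_mem_lincomb[OF k(1,1) \<theta>, of "2 ^ n" 0] by simp
  have "AE y in M'. T (f n) y \<le> T (\<lambda>x. 2 ^ n * k x) y"
    using Tf[of n] A(4) B(4) k(3) T_scale[OF Dom_of_Z[OF k(1)], of "2 ^ n"]
  proof eventually_elim
    case (elim y)
    have "T (f n) y \<le> a n y powr (1 - \<theta>) * b n y powr \<theta>" using elim(1) by linarith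
    also have "\<dots> \<le> (2 ^ n * A y) powr (1 - \<theta>) * (2 ^ n * B y) powr \<theta>"
      using ab elim \<theta> by (intro powr_product_mono) auto
    also have "\<dots> = 2 ^ n * H y" unfolding H_def using A B by (intro powr_product_scale) auto
    finally show ?case using elim by simp
  qed
  then have "AE x in M. f n x \<le> 2 ^ n * k x" by (rule iso_reflects_le[OF f(1) Zk])
  then have "AE x in M. \<bar>f n x\<bar> \<le> (4 ^ n / K) * \<bar>k x\<bar>"
  proof eventually_elim
    case (elim x)
    have "(2::real) ^ n * 2 ^ n = 4 ^ n" by (simp flip: power_mult_distrib)
    moreover have "2 ^ n * K \<le> 2 ^ n * 2 ^ n" using n by (intro mult_left_mono) auto
    ultimately have "2 ^ n \<le> 4 ^ n / K" using K by (simp add: field_simps)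
    then have "2 ^ n * k x \<le> 4 ^ n / K * k x" using k(2) by (rule mult_right_mono)
    then show ?case using elim f(2)[of n x] k(2)[of x] by simp
  qed
  then have "calderon_le M NX0 NX1 \<theta> (4 ^ n / K * K) (f n)"
    using K f(1)[of n] by (intro X.calderon_le_dominated) (auto simp: lat_mem_def)
  then show False using large[of n] K by simp
qed

text \<open>Cancellation is applied to \<open>p\<close>. For \<open>v\<close> in the unit ball of
  \<open>NX1\<close>, \<open>T_calderon_le\<close> bounds the image of the mixed product by
  \<open>3 * H\<close>, with \<open>H\<close> built from \<open>T p\<close> and \<open>T v\<close>.
  Reflecting the order bounds the product itself by three times the preimage of \<open>H\<close>,
  which \<open>iso_inverse_bounded\<close> controls uniformly in \<open>p\<close> and
  \<open>v\<close>.\<close>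

lemma preimage_norm0_le:
  obtains L where "0 < L"
    "\<And>p. Z \<theta> p \<Longrightarrow> (\<And>x. 0 \<le> p x) \<Longrightarrow> NY0 (T p) \<le> 1 \<Longrightarrow> NX0 p \<le> ennreal L"
proof -
  obtain C where C: "0 < C" and inv: "\<And>f. Z \<theta> f \<Longrightarrow> (\<And>x. 0 \<le> f x) \<Longrightarrow>
    calderon_le M' NY0 NY1 \<theta> 1 (T f) \<Longrightarrow> calderon_le M NX0 NX1 \<theta> C f"
    using iso_inverse_bounded by blast
  obtain c where c: "0 \<le> c" "\<And>f. lat_mem M NX1 f \<Longrightarrow> NY1 (T f) \<le> ennreal c * NX1 f"
    using T_bounded1 by blast
  \<comment> \<open>A common bound for both factors of \<open>H\<close>: 1 for \<open>T p\<close>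
    and \<open>c\<close> for \<open>T v\<close>, made positive so that one can divide by it.\<close>
  define E where "E = 1 + c"
  have E: "0 < E" "1 \<le> E" "c \<le> E" using c by (auto simp: E_def)
  obtain e where e: "Z \<theta> e" "\<And>x. 0 \<le> e x" "AE x in M. 0 < e x"
    using X.calderon_weak_unit_obtain by blast
  have [measurable]: "e \<in> borel_measurable M" using e(1) by (simp add: lat_mem_def)
  have "NX0 p \<le> ennreal ((4 * (3 * E * C)) powr (1 / (1 - \<theta>)))"
    if p: "Z \<theta> p" "\<And>x. 0 \<le> p x" "NY0 (T p) \<le> 1" for p
  proof (rule X.calderon_cancellation[OF \<theta>])
    show p_meas[measurable]: "p \<in> borel_measurable M" using p(1) by (simp add: lat_mem_def)
    fix v :: "'a \<Rightarrow> real"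
    assume v[measurable]: "v \<in> borel_measurable M" and v0: "\<And>x. 0 \<le> v x" and vN: "NX1 v \<le> 1"
    have vX: "lat_mem M NX1 v" using vN by (auto simp: lat_mem_def intro: le_less_trans)
    note Dp = Dom_of_Z[OF p(1)] and Dv = X.sum_mem_of_mem1[OF vX]
    have [measurable]: "T p \<in> borel_measurable M'" "T v \<in> borel_measurable M'" using Dp Dv by auto
    define H where "H y = \<bar>T p y\<bar> powr (1 - \<theta>) * \<bar>T v y\<bar> powr \<theta>" for y
    have H_meas[measurable]: "H \<in> borel_measurable M'" unfolding H_def by measurable
    have HE: "calderon_le M' NY0 NY1 \<theta> E H"
    proof (rule calderon_leI[where a = "\<lambda>y. \<bar>T p y\<bar>" and b = "\<lambda>y. \<bar>T v y\<bar>"])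
      have "1 \<le> ennreal E" using E ennreal_leI[of 1 E] by simp
      with p(3) have "NY0 (T p) \<le> ennreal E" by (rule order_trans)
      then show "NY0 (\<lambda>y. \<bar>T p y\<bar>) \<le> ennreal E" by (simp add: Y.X0.norm_abs)
      have "NY1 (T v) \<le> ennreal c * 1"
        using c(2)[OF vX] vN by (meson mult_left_mono order_trans zero_le)
      also have "\<dots> \<le> ennreal E" using E by (simp add: ennreal_leI)
      finally show "NY1 (\<lambda>y. \<bar>T v y\<bar>) \<le> ennreal E" by (simp add: Y.X1.norm_abs)
    qed (auto simp: H_def)
    then have WH: "W \<theta> H" using E Y.lat_mem_calderon_iff by blast
    then obtain k where k: "Z \<theta> k" "\<And>x. 0 \<le> k x" "AE y in M'. T k y = H y"
      by (rule iso_preimage_nonneg) (auto simp: H_def)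
    have Zscale: "Z \<theta> (\<lambda>x. r * k x)" for r using X.calderon_mem_lincomb[OF k(1,1) \<theta>, of r 0] by simp
    \<comment> \<open>The bound \<open>inv\<close> concerns the unit ball, hence the rescaling by
      \<open>1 / E\<close>.\<close>
    have "calderon_le M NX0 NX1 \<theta> C (\<lambda>x. 1 / E * k x)"
    proof (rule inv[OF Zscale])
      have "AE y in M'. \<bar>T (\<lambda>x. 1 / E * k x) y\<bar> \<le> 1 / E * \<bar>H y\<bar>"
        using T_scale[OF Dom_of_Z[OF k(1)], of "1 / E"] k(3)
        by eventually_elim (use E in \<open>simp add: abs_mult\<close>)
      then have "calderon_le M' NY0 NY1 \<theta> (1 / E * E) (T (\<lambda>x. 1 / E * k x))"
        using E by (intro Y.calderon_le_dominated[OF HE] T_measurable Dom_of_Z Zscale) auto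
      then show "calderon_le M' NY0 NY1 \<theta> 1 (T (\<lambda>x. 1 / E * k x))" using E by simp
    qed (use k E in auto)
    note kC = this
    \<comment> \<open>\<open>v\<close> may lie outside the Calderon product on which
      \<open>T\<close> is known to reflect the order. Truncation at multiples of the weak unit
      \<open>e\<close> brings it inside; since \<open>e > 0\<close> a.e., the truncation is inactive
      for large \<open>m\<close>.\<close>
    have "AE x in M. \<forall>m::nat. p x powr (1 - \<theta>) * min (v x) (real m * e x) powr \<theta> \<le> 3 * k x"
      unfolding AE_all_countable
    proof
      fix m :: nat
      define w where "w x = min (v x) (real m * e x)" for x
      define g where "g x = p x powr (1 - \<theta>) * w x powr \<theta>" for x
      have [measurable]: "w \<in> borel_measurable M" unfolding w_def by measurable
      have [measurable]: "g \<in> borel_measurable M" unfolding g_def by measurable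
      have w0: "0 \<le> w x" for x using v0 e by (simp add: w_def)
      have "Z \<theta> w"
        by (rule X.calderon_mem_dominated[OF e(1), where c = "real m"]) (use v0 e in \<open>auto simp: w_def min_def\<close>)
      have "Z \<theta> (\<lambda>x. 1 * p x + 1 * w x)" by (intro X.calderon_mem_lincomb p(1) \<open>Z \<theta> w\<close> \<theta>)
      then have Zg: "Z \<theta> g"
      proof (rule X.calderon_mem_dominated[where c = 1])
        show "AE x in M. \<bar>g x\<bar> \<le> 1 * \<bar>1 * p x + 1 * w x\<bar>"
          using powr_product_le_sum[OF p(2) w0 zero_less_one \<theta>] p(2) w0 by (auto simp: g_def abs_mult)
      qed measurable
      have "AE y in M'. \<bar>T g y\<bar> \<le> 3 * (T p y powr (1 - \<theta>) * T w y powr \<theta>)"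
        using Dom_of_Z[OF Zg] Dp Dom_of_Z[OF \<open>Z \<theta> w\<close>] p(2) w0 \<theta>
        by (rule T_calderon_le) (auto simp: g_def)
      moreover have "AE y in M'. 0 \<le> T p y" using Dp p(2) by (intro T_nonneg) auto
      moreover have "AE y in M'. 0 \<le> T w y" using Dom_of_Z[OF \<open>Z \<theta> w\<close>] w0 by (intro T_nonneg) auto
      moreover have "AE y in M'. T w y \<le> T v y"
        using Dom_of_Z[OF \<open>Z \<theta> w\<close>] Dv by (intro T_mono) (auto simp: w_def)
      moreover note k(3) T_scale[OF Dom_of_Z[OF k(1)], of 3]
      ultimately have "AE y in M'. T g y \<le> T (\<lambda>x. 3 * k x) y"
      proof eventually_elim
        case (elim y)
        have "T p y powr (1 - \<theta>) * T w y powr \<theta> \<le> H y"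
          unfolding H_def using elim \<theta> by (intro powr_product_mono) auto
        then show ?case using elim by simp
      qed
      then show "AE x in M. p x powr (1 - \<theta>) * min (v x) (real m * e x) powr \<theta> \<le> 3 * k x"
        using iso_reflects_le[OF Zg Zscale] by (simp add: g_def w_def)
    qed
    with e(3) have "AE x in M. \<bar>p x powr (1 - \<theta>) * v x powr \<theta>\<bar> \<le> 3 * E * \<bar>1 / E * k x\<bar>"
    proof eventually_elim
      case (elim x)
      obtain m :: nat where "v x / e x \<le> real m" using real_arch_simple by blast
      then have "min (v x) (real m * e x) = v x" using elim(1) by (simp add: divide_le_eq min_absorb1)
      then have "p x powr (1 - \<theta>) * v x powr \<theta> \<le> 3 * k x" using elim(2) by metis
      then show ?case using k(2)[of x] E by (simp add: abs_mult)
    qed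
    then show "calderon_le M NX0 NX1 \<theta> (3 * E * C) (\<lambda>x. p x powr (1 - \<theta>) * v x powr \<theta>)"
      using E C by (intro X.calderon_le_dominated[OF kC]) auto
  qed (use C E p in auto)
  then show ?thesis using C E by (intro that[of "(4 * (3 * E * C)) powr (1 / (1 - \<theta>))"]) auto
qed

text \<open>A substitute for the preimage of \<open>g\<close>, which may lie outside the Calderon
  product. The preimages of its truncations increase and are bounded in \<open>NX0\<close> by
  \<open>preimage_norm0_le\<close>, so the Fatou property gives them a common majorant.\<close>

lemma preimage_majorant0:
  assumes g: "lat_mem M' NY0 g" "\<And>y. 0 \<le> g y" and e: "W \<theta> e" "\<And>y. 0 \<le> e y"
  obtains p where "lat_mem M NX0 p" "\<And>x. 0 \<le> p x"
    "\<And>m s. Z \<theta> s \<Longrightarrow> AE y in M'. T s y = min (g y) (real m * e y) \<Longrightarrow> AE x in M. s x \<le> p x"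
proof -
  obtain L where L: "0 < L"
    "\<And>p. Z \<theta> p \<Longrightarrow> (\<And>x. 0 \<le> p x) \<Longrightarrow> NY0 (T p) \<le> 1 \<Longrightarrow> NX0 p \<le> ennreal L"
    using preimage_norm0_le by blast
  have [measurable]: "g \<in> borel_measurable M'" "e \<in> borel_measurable M'" using g e by (auto simp: lat_mem_def)
  obtain G where G: "0 < G" "NY0 g \<le> ennreal G" using Y.X0.norm_bounded_obtain[OF g(1)] .
  have Wmin: "W \<theta> (\<lambda>y. min (g y) (real m * e y))" for m :: nat
    by (rule Y.calderon_mem_dominated[OF e(1), where c = "real m"]) (use g e in \<open>auto simp: min_def\<close>)
  have "\<exists>s. Z \<theta> s \<and> (\<forall>x. 0 \<le> s x) \<and> (AE y in M'. T s y = min (g y) (real m * e y))" for m :: nat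
  proof -
    obtain s where "Z \<theta> s" "\<And>x. 0 \<le> s x" "AE y in M'. T s y = min (g y) (real m * e y)"
      by (rule iso_preimage_nonneg[OF Wmin[of m]]) (use g e in auto)
    then show ?thesis by blast
  qed
  then obtain s where s: "\<And>m. Z \<theta> (s m)" "\<And>m x. 0 \<le> s m x"
    "\<And>m::nat. AE y in M'. T (s m) y = min (g y) (real m * e y)" by metis
  have s_meas[measurable]: "s m \<in> borel_measurable M" for m using s(1)[of m] by (simp add: lat_mem_def)
  have s_norm: "NX0 (s m) \<le> ennreal (G * L)" for m
  proof -
    have Zs: "Z \<theta> (\<lambda>x. 1 / G * s m x)" using X.calderon_mem_lincomb[OF s(1,1) \<theta>, of "1 / G" m 0] by simp
    have "NY0 (T (\<lambda>x. 1 / G * s m x)) \<le> NY0 (\<lambda>y. 1 / G * g y)"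
    proof (rule Y.X0.norm_mono)
      show "AE y in M'. \<bar>T (\<lambda>x. 1 / G * s m x) y\<bar> \<le> \<bar>1 / G * g y\<bar>"
        using T_scale[OF Dom_of_Z[OF s(1)], of "1 / G" m] s(3)[of m]
      proof eventually_elim
        case (elim y)
        have "0 \<le> min (g y) (real m * e y)" using g e by simp
        then show ?case using elim G g(2)[of y] by (auto simp: abs_mult intro!: divide_right_mono)
      qed
    qed (use Dom_of_Z[OF Zs] in auto)
    also have "\<dots> \<le> ennreal (1 / G * G)" using G by (intro Y.X0.norm_scale_le) auto
    finally have "NX0 (\<lambda>x. 1 / G * s m x) \<le> ennreal L" using Zs s G by (intro L(2)) auto
    then have "NX0 (\<lambda>x. G * (1 / G * s m x)) \<le> ennreal (G * L)"
      using G L by (intro X.X0.norm_scale_le) auto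
    then show ?thesis using G by simp
  qed
  have s_inc: "AE x in M. \<forall>m. 0 \<le> s m x \<and> s m x \<le> s (Suc m) x"
    unfolding AE_all_countable
  proof
    fix m
    have "AE y in M'. T (s m) y \<le> T (s (Suc m)) y"
      using s(3)[of m] s(3)[of "Suc m"]
    proof eventually_elim
      case (elim y)
      have "real m * e y \<le> real (Suc m) * e y" using e by (intro mult_right_mono) auto
      then show ?case using elim by auto
    qed
    then have "AE x in M. s m x \<le> s (Suc m) x" by (rule iso_reflects_le[OF s(1,1)])
    then show "AE x in M. 0 \<le> s m x \<and> s m x \<le> s (Suc m) x" using s(2) by auto
  qed
  obtain p where p: "p \<in> borel_measurable M" "\<And>x. 0 \<le> p x" "NX0 p \<le> ennreal (G * L)"
      "AE x in M. \<forall>m. s m x \<le> p x"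
    by (rule X.X0.increasing_majorant[OF s_meas s_norm _ s_inc]) (use G L in auto)
  have "AE x in M. u x \<le> p x" if u: "Z \<theta> u" "AE y in M'. T u y = min (g y) (real m * e y)" for u and m :: nat
  proof -
    have "AE y in M'. T u y \<le> T (s m) y" using u(2) s(3)[of m] by eventually_elim simp
    then have "AE x in M. u x \<le> s m x" by (rule iso_reflects_le[OF u(1) s(1)])
    then show ?thesis using p(4) by eventually_elim (meson order_trans)
  qed
  then show ?thesis using p by (intro that[of p]) (auto simp: lat_mem_def intro: le_less_trans)
qed

text \<open>Exchanging the end points turns \<theta> into \<open>1 - \<theta>\<close>, so the
  majorant at the first end point also gives the one at the second.\<close>

lemma swapped: "calderon_isomorphism M NX1 NX0 M' NY1 NY0 T (1 - \<theta>)"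
proof -
  have swap: "sum_mem N N1 N0 f \<longleftrightarrow> sum_mem N N0 N1 f" for N :: "'c measure" and N0 N1 f
    unfolding sum_mem_def by (subst ex_comm) (auto simp: add.commute conj_commute conj_left_commute)
  show ?thesis
  proof unfold_locales
    show "positive_operator M NX1 NX0 M' NY1 NY0 T"
      using positive unfolding positive_operator_def swap[of M NX1] by blast
    show "order_isomorphism M (calderon M NX1 NX0 (1 - \<theta>)) M' (calderon M' NY1 NY0 (1 - \<theta>)) T"
      using iso by (simp add: calderon_swap)
  qed (use \<theta> X.X0.lattice X.X0.fatou X.X1.lattice X.X1.fatou
      Y.X0.lattice Y.X0.fatou Y.X1.lattice Y.X1.fatou in auto)
qed

lemma preimage_majorant1:
  assumes "lat_mem M' NY1 g" "\<And>y. 0 \<le> g y" "W \<theta> e" "\<And>y. 0 \<le> e y"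
  obtains p where "lat_mem M NX1 p" "\<And>x. 0 \<le> p x"
    "\<And>m s. Z \<theta> s \<Longrightarrow> AE y in M'. T s y = min (g y) (real m * e y) \<Longrightarrow> AE x in M. s x \<le> p x"
  using calderon_isomorphism.preimage_majorant0[OF swapped, unfolded calderon_swap, OF assms] by blast

end

section \<open>Transfer to another parameter\<close>

context calderon_isomorphism
begin

text \<open>A factorization of \<open>g\<close> is pulled back to a product of the majorants
  \<open>p\<close> and \<open>q\<close> of the preimages of its truncated factors. This product has
  the parameter \<open>t\<close>, although the inverse of \<open>T\<close> is used only at
  \<theta>.\<close>

lemma calderon_image_majorant:
  assumes g: "W t g" and t: "0 < t" "t < 1"
  obtains f where "Z t f" "\<And>x. 0 \<le> f x" "AE y in M'. \<bar>g y\<bar> \<le> T f y"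
proof -
  obtain a b where ab: "lat_mem M' NY0 a" "lat_mem M' NY1 b" "\<And>y. 0 \<le> a y" "\<And>y. 0 \<le> b y"
    and gle: "AE y in M'. \<bar>g y\<bar> \<le> a y powr (1 - t) * b y powr t" using Y.calderon_mem_obtain[OF g] by blast
  obtain e where e: "W \<theta> e" "\<And>y. 0 \<le> e y" "AE y in M'. 0 < e y"
    using Y.calderon_weak_unit_obtain by blast
  have [measurable]: "a \<in> borel_measurable M'" "b \<in> borel_measurable M'" "e \<in> borel_measurable M'"
    using ab e by (auto simp: lat_mem_def)
  obtain p where p: "lat_mem M NX0 p" "\<And>x. 0 \<le> p x"
    "\<And>m s. Z \<theta> s \<Longrightarrow> AE y in M'. T s y = min (a y) (real m * e y) \<Longrightarrow> AE x in M. s x \<le> p x"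
    using preimage_majorant0[OF ab(1,3) e(1,2)] by blast
  obtain q where q: "lat_mem M NX1 q" "\<And>x. 0 \<le> q x"
    "\<And>m s. Z \<theta> s \<Longrightarrow> AE y in M'. T s y = min (b y) (real m * e y) \<Longrightarrow> AE x in M. s x \<le> q x"
    using preimage_majorant1[OF ab(2,4) e(1,2)] by blast
  \<comment> \<open>The 3 is the constant of \<open>le_powr_product_of_le_sums\<close>.\<close>
  define f where "f x = 3 * (p x powr (1 - t) * q x powr t)" for x
  have Zpq: "Z t (\<lambda>x. p x powr (1 - t) * q x powr t)" using p q by (intro X.calderon_mem_product)
  have Zf: "Z t f" unfolding f_def using X.calderon_mem_lincomb[OF Zpq Zpq t, of 3 0] by simp
  have Df: "Dom f" using X.sum_mem_of_calderon_mem[OF Zf t] .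
  have Wmin: "W \<theta> (\<lambda>y. min (h y) (real m * e y))"
    if "h \<in> borel_measurable M'" "\<And>y. 0 \<le> h y" for h and m :: nat
    by (rule Y.calderon_mem_dominated[OF e(1), where c = "real m"]) (use that e in \<open>auto simp: min_def\<close>)
  have "AE y in M'. \<forall>m::nat. min (a y) (real m * e y) powr (1 - t) * min (b y) (real m * e y) powr t \<le> T f y"
    unfolding AE_all_countable
  proof
    fix m :: nat
    let ?a = "\<lambda>y. min (a y) (real m * e y)" and ?b = "\<lambda>y. min (b y) (real m * e y)"
    define G where "G y = ?a y powr (1 - t) * ?b y powr t" for y
    obtain u where u: "Z \<theta> u" "\<And>x. 0 \<le> u x" "AE y in M'. T u y = ?a y"
      by (rule iso_preimage_nonneg[OF Wmin[of a m]]) (use ab e in auto)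
    obtain v where v: "Z \<theta> v" "\<And>x. 0 \<le> v x" "AE y in M'. T v y = ?b y"
      by (rule iso_preimage_nonneg[OF Wmin[of b m]]) (use ab e in auto)
    have a0: "0 \<le> ?a y" and b0: "0 \<le> ?b y" for y using ab e by auto
    have [measurable]: "G \<in> borel_measurable M'" unfolding G_def by measurable
    \<comment> \<open>Both truncated factors are below \<open>m * e\<close>, hence so is their
      product with any exponent; this places \<open>G\<close>, built with exponent \<open>t\<close>,
      in the product with parameter \<theta>.\<close>
    have "W \<theta> G"
    proof (rule Y.calderon_mem_dominated[OF e(1), where c = "real m"])
      show "AE y in M'. \<bar>G y\<bar> \<le> real m * \<bar>e y\<bar>"
      proof (rule AE_I2)
        fix y
        have "G y \<le> (real m * e y) powr (1 - t) * (real m * e y) powr t"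
          unfolding G_def using a0 b0 t by (intro powr_product_mono) auto
        also have "\<dots> = real m * e y" using e(2)[of y] by (simp flip: powr_add)
        finally show "\<bar>G y\<bar> \<le> real m * \<bar>e y\<bar>" using e(2)[of y] by (simp add: G_def abs_mult)
      qed
    qed measurable
    then obtain k where k: "Z \<theta> k" "\<And>x. 0 \<le> k x" "AE y in M'. T k y = G y"
      by (rule iso_preimage_nonneg) (auto simp: G_def)
    \<comment> \<open>The argument of \<open>T_calderon_le\<close> for the inverse: order reflection
      pulls the linear majorants back, one \<open>s\<close> at a time.\<close>
    have "AE x in M. k x \<le> s powr t * u x + s powr (t - 1) * v x" if "0 < s" for s
    proof (rule iso_reflects_le[OF k(1)])
      show "Z \<theta> (\<lambda>x. s powr t * u x + s powr (t - 1) * v x)"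
        by (intro X.calderon_mem_lincomb u v \<theta>)
      show "AE y in M'. T k y \<le> T (\<lambda>x. s powr t * u x + s powr (t - 1) * v x) y"
        using k(3) u(3) v(3) T_lincomb[OF Dom_of_Z[OF u(1)] Dom_of_Z[OF v(1)], of "s powr t" "s powr (t - 1)"]
        by eventually_elim (simp add: G_def powr_product_le_sum[OF a0 b0 that t])
    qed
    then have "AE x in M. \<forall>s\<in>\<rat>. 0 < s \<longrightarrow> k x \<le> s powr t * u x + s powr (t - 1) * v x"
      by (subst AE_ball_countable) (auto simp: countable_rat)
    then have "AE x in M. k x \<le> f x"
      using p(3)[OF u(1,3)] q(3)[OF v(1,3)]
    proof eventually_elim
      case (elim x)
      have "k x \<le> 3 * (u x powr (1 - t) * v x powr t)"
        using elim(1) u(2) v(2) t by (intro le_powr_product_of_le_sums) auto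
      also have "\<dots> \<le> f x" unfolding f_def
        using elim u(2) v(2) t by (intro mult_left_mono powr_product_mono) auto
      finally show ?case .
    qed
    then have "AE y in M'. T k y \<le> T f y" by (rule T_mono[OF Dom_of_Z[OF k(1)] Df])
    then show "AE y in M'. ?a y powr (1 - t) * ?b y powr t \<le> T f y"
      using k(3) by eventually_elim (simp add: G_def)
  qed
  then have "AE y in M'. \<bar>g y\<bar> \<le> T f y"
    using e(3) gle
  proof eventually_elim
    case (elim y)
    obtain m :: nat where "max (a y / e y) (b y / e y) \<le> real m" using real_arch_simple by blast
    then have "min (a y) (real m * e y) = a y" "min (b y) (real m * e y) = b y"
      using elim(2) by (simp_all add: divide_le_eq min_absorb1)
    then have "a y powr (1 - t) * b y powr t \<le> T f y" using elim(1) by metis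
    then show ?case using elim(3) by linarith
  qed
  then show ?thesis using that[OF Zf] by (simp add: f_def)
qed

text \<open>With \<open>g \<le> T f\<close>, the functions \<open>min g (T (fn n))\<close> have
  preimages \<open>k n\<close> under the isomorphism at \<theta>, where \<open>fn n\<close> is
  \<open>f\<close> cut to \<open>A n\<close>. The increments of \<open>k n\<close> are bounded by
  those of \<open>fn n\<close>, so the distance from \<open>k n\<close> to its limit is bounded by
  \<open>f\<close> off \<open>A n\<close>, whose image tends to 0 by
  \<open>calderon_truncation\<close>.\<close>

lemma calderon_surjective_nonneg:
  assumes g: "W t g" "\<And>y. 0 \<le> g y" and t: "0 < t" "t < 1"
  obtains k where "Z t k" "AE y in M'. T k y = g y"
proof -
  have [measurable]: "g \<in> borel_measurable M'" using g by (simp add: lat_mem_def)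
  obtain f where f: "Z t f" "\<And>x. 0 \<le> f x" "AE y in M'. \<bar>g y\<bar> \<le> T f y"
    using calderon_image_majorant[OF g(1) t] by blast
  have [measurable]: "f \<in> borel_measurable M" using f by (simp add: lat_mem_def)
  have Df: "Dom f" using X.sum_mem_of_calderon_mem[OF f(1) t] .
  obtain A where A[measurable]: "\<And>n. A n \<in> sets M" and incA: "incseq A"
    and ZA: "\<And>n g. g \<in> borel_measurable M \<Longrightarrow> AE x in M. \<bar>g x\<bar> \<le> \<bar>f x\<bar> \<Longrightarrow> Z \<theta> (\<lambda>x. g x * indicator (A n) x)"
    and off: "AE y in M'. (\<lambda>n. T (\<lambda>x. \<bar>f x\<bar> * indicator (- A n) x) y) \<longlonglongrightarrow> 0"
    and approx: "\<And>g. g \<in> borel_measurable M \<Longrightarrow> AE x in M. \<bar>g x\<bar> \<le> \<bar>f x\<bar> \<Longrightarrow>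
       AE y in M'. (\<lambda>n. T (\<lambda>x. g x * indicator (A n) x) y) \<longlonglongrightarrow> T g y"
  proof (rule calderon_truncation[OF f(1) t \<theta>], goal_cases)
    case (1 A) show ?case by (rule 1(1)[OF 1(2,3,5,6,7)])
  qed
  define fn where "fn n x = f x * indicator (A n) x" for n x
  have Zfn: "Z \<theta> (fn n)" for n unfolding fn_def by (rule ZA) auto
  note Dfn = Dom_of_Z[OF Zfn]
  have [measurable]: "T (fn n) \<in> borel_measurable M'" for n using Dfn by simp
  have fn0: "0 \<le> fn n x" for n x using f(2) by (simp add: fn_def)
  have fn_mono: "fn n x \<le> fn m x" if "n \<le> m" for n m x
    using incA[THEN incseqD, OF that] f(2)[of x] by (auto simp: fn_def indicator_def)
  \<comment> \<open>The absolute value makes \<open>h n\<close> nonnegative everywhere; a.e. it has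
    no effect, as \<open>T (fn n) \<ge> 0\<close>.\<close>
  define h where "h n y = min (g y) \<bar>T (fn n) y\<bar>" for n y
  have Tfn0: "AE y in M'. \<forall>n. 0 \<le> T (fn n) y"
    unfolding AE_all_countable using fn0 by (auto intro: T_nonneg Dfn)
  have [measurable]: "h n \<in> borel_measurable M'" for n unfolding h_def by measurable
  have Wh: "W \<theta> (h n)" for n
    by (rule Y.calderon_mem_dominated[OF T_calderon_mem[OF Zfn[of n] \<theta>], where c = 1]) (use g(2) in \<open>auto simp: h_def min_def\<close>)
  have "\<exists>k. Z \<theta> k \<and> (\<forall>x. 0 \<le> k x) \<and> (AE y in M'. T k y = h n y)" for n
  proof -
    obtain k where "Z \<theta> k" "\<And>x. 0 \<le> k x" "AE y in M'. T k y = h n y"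
      by (rule iso_preimage_nonneg[OF Wh[of n]]) (use g(2) in \<open>auto simp: h_def\<close>)
    then show ?thesis by blast
  qed
  then obtain k where k: "\<And>n. Z \<theta> (k n)" "\<And>n x. 0 \<le> k n x" "\<And>n. AE y in M'. T (k n) y = h n y" by metis
  note Dk = Dom_of_Z[OF k(1)]
  have [measurable]: "k n \<in> borel_measurable M" for n using k(1)[of n] by (simp add: lat_mem_def)
  have Tfn_mono: "AE y in M'. T (fn n) y \<le> T (fn m) y" if "n \<le> m" for n m
    using fn_mono[OF that] by (intro T_mono Dfn) auto
  have k_inc: "AE x in M. k n x \<le> k m x" if "n \<le> m" for n m
  proof (rule iso_reflects_le[OF k(1) k(1)])
    show "AE y in M'. T (k n) y \<le> T (k m) y"
      using k(3)[of n] k(3)[of m] Tfn_mono[OF that] Tfn0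
    proof eventually_elim
      case (elim y)
      then have "0 \<le> T (fn n) y" "0 \<le> T (fn m) y" by auto
      then show ?case using elim by (auto simp: h_def)
    qed
  qed
  \<comment> \<open>The map \<open>z \<mapsto> min (g y) z\<close> is increasing and 1-Lipschitz, so
    this holds for the images and is reflected by \<open>T\<close>.\<close>
  have k_diff: "AE x in M. k m x - k n x \<le> fn m x - fn n x" if "n \<le> m" for n m
  proof (rule iso_reflects_le)
    show "Z \<theta> (\<lambda>x. k m x - k n x)" using X.calderon_mem_lincomb[OF k(1,1) \<theta>, of 1 m "-1" n] by simp
    show "Z \<theta> (\<lambda>x. fn m x - fn n x)" using X.calderon_mem_lincomb[OF Zfn Zfn \<theta>, of 1 m "-1" n] by simp
    show "AE y in M'. T (\<lambda>x. k m x - k n x) y \<le> T (\<lambda>x. fn m x - fn n x) y"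
      using T_diff(2)[OF Dk Dk, of m n] T_diff(2)[OF Dfn Dfn, of m n] k(3)[of n] k(3)[of m]
        Tfn_mono[OF that] Tfn0
    proof eventually_elim
      case (elim y)
      then have "0 \<le> T (fn n) y" "0 \<le> T (fn m) y" by auto
      then show ?case using elim by (auto simp: h_def)
    qed
  qed
  have k_le: "AE x in M. k n x \<le> fn n x" for n
  proof (rule iso_reflects_le[OF k(1) Zfn])
    show "AE y in M'. T (k n) y \<le> T (fn n) y"
      using k(3)[of n] Tfn0 by eventually_elim (simp add: h_def abs_of_nonneg)
  qed
  define K where "K x = lim (\<lambda>n. k n x)" for x
  have K_meas[measurable]: "K \<in> borel_measurable M" unfolding K_def by measurable
  have "AE x in M. \<forall>n. \<forall>m. n \<le> m \<longrightarrow> k n x \<le> k m x \<and> k m x - k n x \<le> fn m x - fn n x"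
    unfolding AE_all_countable using k_inc k_diff by (auto intro!: AE_impI)
  moreover have "AE x in M. \<forall>n. k n x \<le> fn n x" using k_le by (simp add: AE_all_countable)
  ultimately have K: "AE x in M. 0 \<le> K x \<and> K x \<le> f x \<and>
      (\<forall>n. k n x \<le> K x \<and> K x - k n x \<le> \<bar>f x\<bar> * indicator (- A n) x)"
  proof eventually_elim
    case (elim x)
    have fnf: "fn n x \<le> f x" for n using f(2)[of x] by (auto simp: fn_def indicator_def)
    have kf: "k n x \<le> f x" for n using elim(2) fnf order_trans by blast
    have "incseq (\<lambda>n. k n x)" using elim(1) by (auto simp: incseq_def)
    then obtain l where l: "(\<lambda>n. k n x) \<longlonglongrightarrow> l" "\<forall>n. k n x \<le> l"
      using incseq_convergent[of "\<lambda>n. k n x" "f x"] kf by blast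
    then have Kl: "K x = l" by (simp add: K_def limI)
    have "l \<le> f x" using l(1) kf by (auto intro: LIMSEQ_le_const2)
    moreover have "0 \<le> l" using l(2) k(2)[of 0 x] by (meson order_trans)
    moreover have "l - k n x \<le> \<bar>f x\<bar> * indicator (- A n) x" for n
    proof -
      have "k m x \<le> k n x + \<bar>f x\<bar> * indicator (- A n) x" if "m \<ge> n" for m
      proof -
        have "k m x - k n x \<le> fn m x - fn n x" using elim(1) that by blast
        also have "\<dots> \<le> \<bar>f x\<bar> * indicator (- A n) x" using f(2)[of x] fnf[of m] by (auto simp: fn_def indicator_def split: if_splits)
        finally show ?thesis by simp
      qed
      then have "l \<le> k n x + \<bar>f x\<bar> * indicator (- A n) x" using l(1) by (auto intro: LIMSEQ_le_const2)
      then show ?thesis by simp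
    qed
    ultimately show ?case using l(2) Kl by simp
  qed
  have ZK: "Z t K"
  proof (rule X.calderon_mem_dominated[OF f(1), where c = 1])
    show "AE x in M. \<bar>K x\<bar> \<le> 1 * \<bar>f x\<bar>" using K by eventually_elim simp
  qed measurable
  note DK = X.sum_mem_of_calderon_mem[OF ZK t]
  have "AE y in M'. \<forall>n. \<bar>T K y - T (k n) y\<bar> \<le> T (\<lambda>x. \<bar>f x\<bar> * indicator (- A n) x) y"
    unfolding AE_all_countable
  proof
    fix n
    have "(\<lambda>x. \<bar>f x\<bar> * (1 - indicator (A n) x)) \<in> borel_measurable M" by measurable
    also have "(\<lambda>x. \<bar>f x\<bar> * (1 - indicator (A n) x)) = (\<lambda>x. \<bar>f x\<bar> * indicator (- A n) x)"
      by (auto simp: indicator_def)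
    finally have DA: "Dom (\<lambda>x. \<bar>f x\<bar> * indicator (- A n) x)"
      by (intro X.sum_mem_dominated[OF Df]) (auto simp: indicator_def)
    have "AE x in M. \<bar>K x - k n x\<bar> \<le> \<bar>f x\<bar> * indicator (- A n) x"
      using K by eventually_elim (simp only: abs_of_nonneg diff_ge_0_iff_ge)
    then have "AE y in M'. \<bar>T (\<lambda>x. K x - k n x) y\<bar> \<le> T (\<lambda>x. \<bar>f x\<bar> * indicator (- A n) x) y"
      by (intro T_abs_le T_diff DK Dk DA)
    then show "AE y in M'. \<bar>T K y - T (k n) y\<bar> \<le> T (\<lambda>x. \<bar>f x\<bar> * indicator (- A n) x) y"
      using T_diff(2)[OF DK Dk[of n]] by eventually_elim simp
  qed
  moreover have "AE y in M'. \<forall>n. T (k n) y = h n y" using k(3) by (simp add: AE_all_countable)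
  moreover have "AE y in M'. (\<lambda>n. T (fn n) y) \<longlonglongrightarrow> T f y" unfolding fn_def by (rule approx) auto
  ultimately have "AE y in M'. T K y = g y" using off f(3)
  proof eventually_elim
    case (elim y)
    have "(\<lambda>n. T K y - T (k n) y) \<longlonglongrightarrow> 0"
      using elim(4) by (rule Lim_null_comparison[rotated]) (use elim(1) in auto)
    then have "(\<lambda>n. T K y - (T K y - T (k n) y)) \<longlonglongrightarrow> T K y - 0" by (intro tendsto_diff) auto
    then have 1: "(\<lambda>n. h n y) \<longlonglongrightarrow> T K y" using elim(2) by simp
    \<comment> \<open>The limit of \<open>h n\<close> is computed a second time, from
      \<open>T (fn n)\<close> tending to \<open>T f\<close>, where the majorization of
      \<open>g\<close> makes the minimum equal to \<open>g\<close>.\<close>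
    have "(\<lambda>n. h n y) \<longlonglongrightarrow> min (g y) \<bar>T f y\<bar>"
      unfolding h_def using elim(3) by (intro tendsto_intros)
    moreover have "min (g y) \<bar>T f y\<bar> = g y" using elim(5) by linarith
    ultimately show ?case using 1 LIMSEQ_unique by metis
  qed
  then show ?thesis using that[OF ZK] by blast
qed

lemma calderon_surjective:
  assumes g: "W t g" and t: "0 < t" "t < 1"
  shows "\<exists>f. Z t f \<and> (AE y in M'. T f y = g y)"
proof -
  have [measurable]: "g \<in> borel_measurable M'" using g by (simp add: lat_mem_def)
  have "W t (\<lambda>y. max 0 (g y))" "W t (\<lambda>y. max 0 (- g y))"
    by (rule Y.calderon_mem_dominated[OF g, where c = 1]; auto)+
  then obtain u v where uv: "Z t u" "AE y in M'. T u y = max 0 (g y)" "Z t v" "AE y in M'. T v y = max 0 (- g y)"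
    using calderon_surjective_nonneg[OF _ _ t, of "\<lambda>y. max 0 (g y)"]
      calderon_surjective_nonneg[OF _ _ t, of "\<lambda>y. max 0 (- g y)"] by (metis max.cobounded1)
  have "Z t (\<lambda>x. u x - v x)" using X.calderon_mem_lincomb[OF uv(1,3) t, of 1 "-1"] by simp
  moreover have "AE y in M'. T (\<lambda>x. u x - v x) y = g y"
    using T_diff(2)[OF uv(1,3)[THEN X.sum_mem_of_calderon_mem[OF _ t]]] uv(2,4) by eventually_elim auto
  ultimately show ?thesis by blast
qed

text \<open>\<open>T\<close> keeps the positive part \<open>u\<close> and the negative part
  \<open>v\<close> of \<open>f\<close> disjoint: this holds for their truncations by the isomorphism
  at \<theta> and passes to the limit. As \<open>T u \<ge> T v\<close>, disjointness forces
  \<open>T v = 0\<close>, and injectivity on the truncations gives \<open>v = 0\<close>.\<close>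

lemma calderon_reflects_nonneg:
  assumes f: "Z t f" and t: "0 < t" "t < 1" and Tf: "AE y in M'. 0 \<le> T f y"
  shows "AE x in M. 0 \<le> f x"
proof -
  have [measurable]: "f \<in> borel_measurable M" using f by (simp add: lat_mem_def)
  have Df: "Dom f" using X.sum_mem_of_calderon_mem[OF f t] .
  obtain A where A[measurable]: "\<And>n. A n \<in> sets M"
    and cover: "AE x in M. f x \<noteq> 0 \<longrightarrow> (\<exists>n. x \<in> A n)"
    and ZA: "\<And>n g. g \<in> borel_measurable M \<Longrightarrow> AE x in M. \<bar>g x\<bar> \<le> \<bar>f x\<bar> \<Longrightarrow> Z \<theta> (\<lambda>x. g x * indicator (A n) x)"
    and approx: "\<And>g. g \<in> borel_measurable M \<Longrightarrow> AE x in M. \<bar>g x\<bar> \<le> \<bar>f x\<bar> \<Longrightarrow>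
       AE y in M'. (\<lambda>n. T (\<lambda>x. g x * indicator (A n) x) y) \<longlonglongrightarrow> T g y"
  proof (rule calderon_truncation[OF f t \<theta>], goal_cases)
    case (1 A) show ?case by (rule 1(1)[OF 1(2,4,5,7)])
  qed
  define u v where "u x = max 0 (f x)" and "v x = max 0 (- f x)" for x
  have [measurable]: "u \<in> borel_measurable M" "v \<in> borel_measurable M" unfolding u_def v_def by measurable
  have uv_le: "AE x in M. \<bar>u x\<bar> \<le> \<bar>f x\<bar>" "AE x in M. \<bar>v x\<bar> \<le> \<bar>f x\<bar>" by (auto simp: u_def v_def)
  have Du: "Dom u" and Dv: "Dom v" using uv_le by (auto intro: X.sum_mem_dominated[OF Df])
  define un vn where "un n x = u x * indicator (A n) x" and "vn n x = v x * indicator (A n) x" for n x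
  have Zu: "Z \<theta> (un n)" and Zv: "Z \<theta> (vn n)" for n unfolding un_def vn_def using uv_le by (auto intro: ZA)
  have zero: "Z \<theta> (\<lambda>x. 0)" and T_zero: "AE y in M'. T (\<lambda>x. 0) y = 0"
    using X.calderon_mem_lincomb[OF Zu Zu \<theta>, of 0 0 0 0] T_lincomb[OF Df Df, of 0 0] by simp_all
  have lim_u: "AE y in M'. (\<lambda>n. T (un n) y) \<longlonglongrightarrow> T u y"
    and lim_v: "AE y in M'. (\<lambda>n. T (vn n) y) \<longlonglongrightarrow> T v y"
    unfolding un_def vn_def using uv_le by (auto intro: approx)
  \<comment> \<open>The preimage of the infimum of the two images lies below both
    \<open>un n\<close> and \<open>vn n\<close>, which are disjoint, so it is 0.\<close>
  have disjoint: "AE y in M'. \<forall>n. min \<bar>T (un n) y\<bar> \<bar>T (vn n) y\<bar> = 0"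
    unfolding AE_all_countable
  proof
    fix n
    have [measurable]: "T (un n) \<in> borel_measurable M'" "T (vn n) \<in> borel_measurable M'"
      using Dom_of_Z[OF Zu] Dom_of_Z[OF Zv] by auto
    have "W \<theta> (\<lambda>y. min \<bar>T (un n) y\<bar> \<bar>T (vn n) y\<bar>)"
      by (rule Y.calderon_mem_dominated[OF T_calderon_mem[OF Zu[of n] \<theta>], where c = 1]) auto
    then obtain k where k: "Z \<theta> k" "\<And>x. 0 \<le> k x" "AE y in M'. T k y = min \<bar>T (un n) y\<bar> \<bar>T (vn n) y\<bar>"
      by (rule iso_preimage_nonneg) auto
    have nn: "AE y in M'. 0 \<le> T (un n) y" "AE y in M'. 0 \<le> T (vn n) y"
      by (auto intro!: T_nonneg Dom_of_Z Zu Zv simp: un_def vn_def u_def v_def)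
    have "AE x in M. k x \<le> un n x"
      using nn(1) k(3) by (intro iso_reflects_le[OF k(1) Zu]) (auto elim!: eventually_elim2)
    moreover have "AE x in M. k x \<le> vn n x"
      using nn(2) k(3) by (intro iso_reflects_le[OF k(1) Zv]) (auto elim!: eventually_elim2)
    ultimately have "AE x in M. k x = 0"
    proof eventually_elim
      case (elim x)
      then show ?case using k(2)[of x] by (auto simp: un_def vn_def u_def v_def max_def indicator_def split: if_splits)
    qed
    then have "AE y in M'. T k y = T (\<lambda>x. 0) y" by (intro T_cong Dom_of_Z k(1) zero)
    then show "AE y in M'. min \<bar>T (un n) y\<bar> \<bar>T (vn n) y\<bar> = 0"
      using T_zero k(3) by eventually_elim simp
  qed
  have Tv0: "AE y in M'. 0 \<le> T v y" using Dv by (intro T_nonneg) (auto simp: v_def)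
  have "f = (\<lambda>x. u x - v x)" by (auto simp: u_def v_def)
  then have "AE y in M'. T f y = T u y - T v y" using T_diff(2)[OF Du Dv] by simp
  then have "AE y in M'. T v y = 0"
    using disjoint lim_u lim_v Tf Tv0
  proof eventually_elim
    case (elim y)
    have "(\<lambda>n. min \<bar>T (un n) y\<bar> \<bar>T (vn n) y\<bar>) \<longlonglongrightarrow> min \<bar>T u y\<bar> \<bar>T v y\<bar>"
      using elim by (intro tendsto_intros)
    then have "min \<bar>T u y\<bar> \<bar>T v y\<bar> = 0" using elim(2) by (simp add: LIMSEQ_const_iff)
    then show ?case using elim by linarith
  qed
  note Tv = this
  \<comment> \<open>It is not known yet that \<open>T\<close> is injective at the parameter
    \<open>t\<close>; the truncations lie in the product with parameter \<theta>, where order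
    reflection applies.\<close>
  have "AE x in M. \<forall>n. vn n x \<le> 0"
    unfolding AE_all_countable
  proof
    fix n
    have "AE y in M'. T (vn n) y \<le> T v y"
      by (intro T_mono Dom_of_Z Zv Dv) (auto simp: vn_def v_def indicator_def)
    then have "AE y in M'. T (vn n) y \<le> T (\<lambda>x. 0) y" using Tv T_zero by eventually_elim simp
    then show "AE x in M. vn n x \<le> 0" by (rule iso_reflects_le[OF Zv zero])
  qed
  then show ?thesis using cover
  proof eventually_elim
    case (elim x)
    show ?case
    proof (rule ccontr)
      assume "\<not> 0 \<le> f x"
      then obtain n where "x \<in> A n" using elim(2) by auto
      then have "vn n x = - f x" using \<open>\<not> 0 \<le> f x\<close> by (simp add: vn_def v_def)
      moreover have "vn n x \<le> 0" using elim(1) by blast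
      ultimately show False using \<open>\<not> 0 \<le> f x\<close> by simp
    qed
  qed
qed

lemma calderon_order_isomorphism:
  assumes t: "0 < t" "t < 1"
  shows "order_isomorphism M (calderon M NX0 NX1 t) M' (calderon M' NY0 NY1 t) T"
  unfolding order_isomorphism_def
proof (intro conjI allI impI)
  fix f g assume fg: "Z t f" "Z t g" "AE y in M'. T f y = T g y"
  \<comment> \<open>Injectivity follows from reflecting nonnegativity, applied to the difference in
    both orders.\<close>
  have "AE x in M. 0 \<le> u x - v x" if uv: "Z t u" "Z t v" "AE y in M'. T u y = T v y" for u v
  proof (rule calderon_reflects_nonneg[OF _ t])
    show "Z t (\<lambda>x. u x - v x)" using X.calderon_mem_lincomb[OF uv(1,2) t, of 1 "-1"] by simp
    show "AE y in M'. 0 \<le> T (\<lambda>x. u x - v x) y"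
      using T_diff(2)[OF uv(1,2)[THEN X.sum_mem_of_calderon_mem[OF _ t]]] uv(3) by eventually_elim simp
  qed
  from this[OF fg] this[OF fg(2,1)] fg(3) have "AE x in M. 0 \<le> f x - g x" "AE x in M. 0 \<le> g x - f x"
    by (auto simp: eq_commute)
  then show "AE x in M. f x = g x" by eventually_elim simp
qed (use t T_calderon_mem calderon_surjective calderon_reflects_nonneg
    T_nonneg X.sum_mem_of_calderon_mem in auto)

end

theorem theorem5p1:
  fixes M :: "'a measure" and M' :: "'b measure"
    and NX0 NX1 :: "('a \<Rightarrow> real) \<Rightarrow> ennreal"
    and NY0 NY1 :: "('b \<Rightarrow> real) \<Rightarrow> ennreal"
    and T :: "('a \<Rightarrow> real) \<Rightarrow> ('b \<Rightarrow> real)"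
    and \<theta>0 \<theta>1 :: real
  assumes "banach_lattice M NX0" and "fatou_property M NX0"
    and "banach_lattice M NX1" and "fatou_property M NX1"
    and "banach_lattice M' NY0" and "fatou_property M' NY0"
    and "banach_lattice M' NY1" and "fatou_property M' NY1"
    and "positive_operator M NX0 NX1 M' NY0 NY1 T"
    and "0 < \<theta>0" and "\<theta>0 < 1"
    and "order_isomorphism M (calderon M NX0 NX1 \<theta>0) M' (calderon M' NY0 NY1 \<theta>0) T"
    and "0 < \<theta>1" and "\<theta>1 < 1"
  shows "order_isomorphism M (calderon M NX0 NX1 \<theta>1) M' (calderon M' NY0 NY1 \<theta>1) T"
proof -
  interpret calderon_isomorphism M NX0 NX1 M' NY0 NY1 T \<theta>0
    by unfold_locales (use assms in auto)
  show ?thesis using assms by (intro calderon_order_isomorphism)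
qed

end
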